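(* Let $G$ be a connected $r$-regular graph with $n$ vertices, $m$ edges and $r\ge 2$. If $r+1$ is prime, then the Q-graph $\mathcal Q(G)$ does not have Laplacian perfect pair state transfer between any two distinct pair states.
   Context: The Q-graph $\mathcal Q(G)$ is obtained from $G$ by inserting a new vertex into each edge of $G$ and joining by an edge each pair of new vertices lying on adjacent edges of $G$. For a simple graph $H$ with Laplacian $L_H=D_H-A_H$ (degree matrix minus adjacency matrix) and characteristic vectors $\mathbf e_u$ of vertices, a pair state is $\mathbf e_a-\mathbf e_b$ for distinct vertices $a,b$. $H$ has Laplacian perfect pair state transfer between distinct pair states $\mathbf e_a-\mathbf e_b$ and $\mathbf e_c-\mathbf e_d$ if there exist $\tau\in\mathbb R$ and $\chi\in\mathbb C$ with $|\chi|=1$ such that $\exp(-\mathrm i\tau L_H)(\mathbf e_a-\mathbf e_b)=\chi(\mathbf e_c-\mathbf e_d)$.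
   Formalization: "Distinct pair states" is read as {a,b} ≠ {c,d}: the pair e_a−e_b and e_b−e_a, which are distinct as vectors but always related by τ=0, χ=−1, is excluded, since the claim fails for it on every graph. *)

theory Defs
  imports Complex_Main "HOL-Computational_Algebra.Primes"
begin

definition simple_graph :: "'v set \<Rightarrow> ('v \<Rightarrow> 'v \<Rightarrow> bool) \<Rightarrow> bool" where
  "simple_graph V A \<longleftrightarrow> finite V \<and> (\<forall>x y. A x y \<longrightarrow> x \<in> V \<and> y \<in> V)
     \<and> (\<forall>x y. A x y \<longrightarrow> A y x) \<and> (\<forall>x. \<not> A x x)"

definition nbrs :: "'v set \<Rightarrow> ('v \<Rightarrow> 'v \<Rightarrow> bool) \<Rightarrow> 'v \<Rightarrow> 'v set" where
  "nbrs V A x = {y \<in> V. A x y}"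

definition regular :: "'v set \<Rightarrow> ('v \<Rightarrow> 'v \<Rightarrow> bool) \<Rightarrow> nat \<Rightarrow> bool" where
  "regular V A r \<longleftrightarrow> (\<forall>x\<in>V. card (nbrs V A x) = r)"

definition connected_graph :: "'v set \<Rightarrow> ('v \<Rightarrow> 'v \<Rightarrow> bool) \<Rightarrow> bool" where
  "connected_graph V A \<longleftrightarrow> V \<noteq> {} \<and>
     (\<forall>x\<in>V. \<forall>y\<in>V. (\<lambda>u v. u \<in> V \<and> v \<in> V \<and> A u v)\<^sup>*\<^sup>* x y)"

definition edges :: "'v set \<Rightarrow> ('v \<Rightarrow> 'v \<Rightarrow> bool) \<Rightarrow> 'v set set" where
  "edges V A = {{u, v} | u v. u \<in> V \<and> v \<in> V \<and> A u v}"

text \<open>The Q-graph: old vertices (Inl) plus one new vertex per edge (Inr);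
each edge is subdivided, and new vertices on adjacent edges are joined.\<close>
definition Q_vertices :: "'v set \<Rightarrow> ('v \<Rightarrow> 'v \<Rightarrow> bool) \<Rightarrow> ('v + 'v set) set" where
  "Q_vertices V A = Inl ` V \<union> Inr ` edges V A"

definition Q_adj :: "'v set \<Rightarrow> ('v \<Rightarrow> 'v \<Rightarrow> bool) \<Rightarrow> ('v + 'v set) \<Rightarrow> ('v + 'v set) \<Rightarrow> bool" where
  "Q_adj V A p q =
    (case (p, q) of
       (Inl u, Inl v) \<Rightarrow> False
     | (Inl u, Inr e) \<Rightarrow> e \<in> edges V A \<and> u \<in> e
     | (Inr e, Inl u) \<Rightarrow> e \<in> edges V A \<and> u \<in> e
     | (Inr e, Inr f) \<Rightarrow> e \<in> edges V A \<and> f \<in> edges V A \<and> e \<noteq> f \<and> e \<inter> f \<noteq> {})"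

definition laplacian :: "'v set \<Rightarrow> ('v \<Rightarrow> 'v \<Rightarrow> bool) \<Rightarrow> ('v \<Rightarrow> complex) \<Rightarrow> ('v \<Rightarrow> complex)" where
  "laplacian V A f = (\<lambda>x. if x \<in> V then
      of_nat (card (nbrs V A x)) * f x - (\<Sum>y\<in>nbrs V A x. f y) else 0)"

definition exp_lap :: "'v set \<Rightarrow> ('v \<Rightarrow> 'v \<Rightarrow> bool) \<Rightarrow> real \<Rightarrow> ('v \<Rightarrow> complex) \<Rightarrow> ('v \<Rightarrow> complex)" where
  "exp_lap V A \<tau> f = (\<lambda>x. \<Sum>k. ((- \<i> * complex_of_real \<tau>) ^ k / fact k) * ((laplacian V A ^^ k) f) x)"

definition char_vec :: "'v \<Rightarrow> 'v \<Rightarrow> complex" where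
  "char_vec a = (\<lambda>x. if x = a then 1 else 0)"

definition pair_state :: "'v \<Rightarrow> 'v \<Rightarrow> 'v \<Rightarrow> complex" where
  "pair_state a b = (\<lambda>x. char_vec a x - char_vec b x)"

definition lap_PPST :: "'v set \<Rightarrow> ('v \<Rightarrow> 'v \<Rightarrow> bool) \<Rightarrow> 'v \<Rightarrow> 'v \<Rightarrow> 'v \<Rightarrow> 'v \<Rightarrow> bool" where
  "lap_PPST V A a b c d \<longleftrightarrow>
     a \<in> V \<and> b \<in> V \<and> c \<in> V \<and> d \<in> V \<and> a \<noteq> b \<and> c \<noteq> d \<and> {a, b} \<noteq> {c, d} \<and>
     (\<exists>\<tau>::real. \<exists>\<chi>::complex. cmod \<chi> = 1 \<and>
        (\<forall>x\<in>V. exp_lap V A \<tau> (pair_state a b) x = \<chi> * pair_state c d x))"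

end

theory Submission
  imports Defs "HOL-Computational_Algebra.Fundamental_Theorem_Algebra"
begin

text \<open>
  Write \<open>p = r + 1\<close> and shift the Laplacian eigenvalues of the Q-graph to \<open>m = \<lambda> - p\<close>. An
  eigenvector of \<open>m\<close> restricts on the old vertices to an eigenvector of the adjacency matrix of
  \<open>G\<close> with eigenvalue \<open>p / m - m\<close>, unless the restriction vanishes, which happens exactly for
  \<open>m = p\<close>. Both \<open>m\<close> and \<open>p / m - m\<close> are algebraic integers and \<open>\<bar>p / m - m\<bar> \<le> r\<close>.

  State transfer from a rational vector \<open>v\<close> to a rational vector \<open>w\<close> at time \<open>\<tau>\<close> forces
  \<open>w = \<Sum> \<epsilon>(\<lambda>) v\<^sub>\<lambda>\<close> with signs \<open>\<epsilon>(\<lambda>)\<close>, where \<open>v\<^sub>\<lambda>\<close> are the spectral components of \<open>v\<close>, so all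
  differences of eigenvalues in the support of \<open>v\<close> are integer multiples of \<open>\<delta> = \<pi> / \<tau>\<close>. The
  polynomial whose simple roots are the support has rational coefficients; its two subleading
  coefficients show that the mean of the support and \<open>\<delta>\<^sup>2\<close> are rational. Hence the support is
  rational, or it is closed under the conjugation \<open>\<delta> \<mapsto> -\<delta>\<close>, which preserves \<open>\<epsilon>\<close> because \<open>\<epsilon>\<close> is
  interpolated by a rational polynomial.

  In the rational case \<open>m\<close> divides the prime \<open>p\<close>, so \<open>m\<close> is \<open>1\<close>, \<open>-1\<close> or \<open>p\<close>, and then \<open>v\<close> takes equal
  values at old vertices joined by a walk of length two, which is impossible for a pair state with
  nonconstant \<open>\<epsilon>\<close>. In the irrational case the norm of a conjugate pair \<open>m, m'\<close> divides \<open>p\<^sup>2\<close> and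
  the bound leaves only \<open>m m' = p\<close> or \<open>m m' = -p\<close>. These cannot coexist, since \<open>t\<^sup>4 - 16 p\<^sup>2\<close> is not
  a square for the trace \<open>t\<close>. So the sign changes at a rational element \<open>m = 1\<close> or \<open>m = -1\<close>, and
  a combination \<open>v \<plusminus> w\<close> is an eigenvector without zeros on the old vertices, which is impossible
  as \<open>v \<plusminus> w\<close> has at most four nonzero entries.
\<close>

section \<open>Rational eigenvalues of integer matrices\<close>

text \<open>Over the rationals, \<open>1\<close> is independent in the complex numbers and extends
  to a basis, so a linear functional can be prescribed there. Applied to an identity with rational
  coefficients, it replaces complex unknowns by rational ones.\<close>

lemma rational_functional:
  obtains \<phi> :: "complex \<Rightarrow> real" where
    "\<And>x y. \<phi> (x + y) = \<phi> x + \<phi> y" "\<And>x. \<phi> x \<in> \<rat>"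
    "\<And>q x. q \<in> \<rat> \<Longrightarrow> \<phi> (complex_of_real q * x) = q * \<phi> x" "\<phi> 1 = 1"
proof -
  interpret vs: vector_space_pair "\<lambda>(q::rat) (z::complex). of_rat q * z" "\<lambda>(q::rat) (z::rat). q * z"
    by unfold_locales (auto simp: algebra_simps of_rat_add of_rat_mult)
  have "\<not> vs.vs1.dependent {1::complex}"
    by (rule vs.vs1.independent_insertI) (auto simp: vs.vs1.independent_empty)
  then obtain g where g: "Vector_Spaces.linear (\<lambda>(q::rat) (z::complex). of_rat q * z) (\<lambda>(q::rat) (z::rat). q * z) g"
     "\<forall>x\<in>{1}. g x = 1"
    using vs.linear_independent_extend[of "{1}" "\<lambda>_. 1"] by metis
  interpret g: Vector_Spaces.linear "\<lambda>(q::rat) (z::complex). of_rat q * z" "\<lambda>(q::rat) (z::rat). q * z" g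
    by (fact g)
  show ?thesis
  proof (rule that[of "\<lambda>z. of_rat (g z)"])
    fix q :: real and x assume "q \<in> \<rat>"
    then obtain q' where q': "q = of_rat q'" by (auto elim: Rats_cases)
    have "complex_of_real q = of_rat q'" unfolding q' by (cases q') (simp add: of_rat_rat)
    then show "real_of_rat (g (complex_of_real q * x)) = q * real_of_rat (g x)"
      using g.scale[of q' x] by (simp add: q' of_rat_mult)
  qed (use g in \<open>auto simp: g.add of_rat_add\<close>)
qed

lemma common_denominator:
  fixes z :: "'a \<Rightarrow> real"
  assumes "finite X" "\<And>x. x \<in> X \<Longrightarrow> z x \<in> \<rat>"
  obtains d :: int where "d > 0" "\<And>x. x \<in> X \<Longrightarrow> of_int d * z x \<in> \<int>"
proof -
  have "\<exists>d::int. d > 0 \<and> (\<forall>x\<in>X. of_int d * z x \<in> \<int>)"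
    using assms
  proof (induction X)
    case (insert x X)
    then obtain d :: int where d: "d > 0" "\<forall>x\<in>X. of_int d * z x \<in> \<int>" by auto
    have "z x \<in> \<rat>" using insert by simp
    then obtain a b :: int where ab: "b > 0" "z x = of_int a / of_int b"
      by (auto elim: Rats_cases')
    have "of_int (d * b) * z y \<in> \<int>" if "y \<in> insert x X" for y
    proof (cases "y = x")
      case True
      then have "of_int (d * b) * z y = of_int (d * a)" using ab by simp
      then show ?thesis by (metis Ints_of_int)
    next
      case False
      then have "of_int d * z y \<in> \<int>" using that d by auto
      then have "of_int b * (of_int d * z y) \<in> \<int>" by auto
      then show ?thesis by (simp add: mult_ac)
    qed
    then show ?case using d(1) ab(1) by (intro exI[of _ "d * b"]) auto
  qed (auto intro: exI[of _ 1])
  then show ?thesis using that by blast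
qed

text \<open>In lowest terms \<open>l = a / b\<close>, every power \<open>b ^ k\<close> divides the
  fixed number \<open>d\<close>, so \<open>b = 1\<close>.\<close>

lemma bounded_denominator_powers_imp_int:
  fixes l :: real
  assumes "l \<in> \<rat>" "d > (0::int)" "\<And>k. of_int d * l ^ k \<in> \<int>"
  shows "l \<in> \<int>"
proof -
  obtain a b :: int where ab: "b > 0" "coprime a b" "l = of_int a / of_int b"
    using assms(1) by (auto elim: Rats_cases')
  have dvd: "b ^ k dvd d" for k
  proof -
    obtain m where "of_int d * l ^ k = real_of_int m" using assms(3) by (auto elim: Ints_cases)
    then have "real_of_int (d * a ^ k) = real_of_int (m * b ^ k)"
      using ab by (simp add: power_divide field_simps)
    then have "d * a ^ k = m * b ^ k" by linarith
    then have "b ^ k dvd d * a ^ k" by simp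
    moreover have "coprime (b ^ k) (a ^ k)" using ab by (simp add: coprime_commute)
    ultimately show ?thesis by (simp add: coprime_dvd_mult_left_iff)
  qed
  have "b = 1"
  proof (rule ccontr)
    assume "b \<noteq> 1"
    then have "b \<ge> 2" using ab by simp
    have "b ^ k > int k" for k
    proof (induction k)
      case (Suc k)
      have "int (Suc k) < 2 * b ^ k" using Suc by simp
      also have "\<dots> \<le> b * b ^ k" using \<open>b \<ge> 2\<close> by (intro mult_right_mono) auto
      finally show ?case by simp
    qed simp
    from this[of "nat d"] dvd[of "nat d"] assms(2) show False
      by (auto dest: zdvd_imp_le)
  qed
  then show ?thesis using ab by simp
qed

text \<open>A certificate that \<open>l\<close> is an algebraic integer. With an explicit
  eigenvector, closure under sums and products becomes a Kronecker construction on pairs of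
  indices.\<close>

definition int_eigen :: "'a set \<Rightarrow> ('a \<Rightarrow> 'a \<Rightarrow> int) \<Rightarrow> real \<Rightarrow> ('a \<Rightarrow> complex) \<Rightarrow> bool" where
  "int_eigen X K l u \<longleftrightarrow> finite X \<and> (\<exists>x\<in>X. u x \<noteq> 0) \<and>
     (\<forall>x\<in>X. (\<Sum>y\<in>X. of_int (K x y) * u y) = of_real l * u x)"

text \<open>A rational-linear functional turns the eigenvector into a rational one for the same
  eigenvalue, and integer powers of the matrix keep its common denominator bounded.\<close>

lemma int_eigen_rat_imp_int:
  assumes "int_eigen X K l u" "l \<in> \<rat>"
  shows "l \<in> \<int>"
proof -
  obtain \<phi> where phi: "\<And>x y. \<phi> (x + y) = \<phi> x + \<phi> y" "\<And>x. \<phi> x \<in> \<rat>"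
    "\<And>q x. q \<in> \<rat> \<Longrightarrow> \<phi> (complex_of_real q * x) = q * \<phi> x" "\<phi> 1 = 1"
    by (rule rational_functional) (assumption | blast)+
  have phi_sum: "\<phi> (\<Sum>y\<in>Y. f y) = (\<Sum>y\<in>Y. \<phi> (f y))" for f and Y :: "'a set"
    using phi(1)[of 0 0] by (induction Y rule: infinite_finite_induct) (auto simp: phi(1))
  obtain x0 where x0: "x0 \<in> X" "u x0 \<noteq> 0" and fin: "finite X"
    using assms by (auto simp: int_eigen_def)
  define z where "z x = \<phi> (u x / u x0)" for x
  have z: "(\<Sum>y\<in>X. of_int (K x y) * z y) = l * z x" if "x \<in> X" for x
  proof -
    have "(\<Sum>y\<in>X. of_int (K x y) * u y) / u x0 = of_real l * u x / u x0"
      using assms that by (auto simp: int_eigen_def)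
    then have "(\<Sum>y\<in>X. complex_of_real (of_int (K x y)) * (u y / u x0)) = of_real l * (u x / u x0)"
      by (simp add: sum_divide_distrib)
    then have "\<phi> (\<Sum>y\<in>X. complex_of_real (of_int (K x y)) * (u y / u x0)) = \<phi> (of_real l * (u x / u x0))"
      by (rule arg_cong)
    then show ?thesis unfolding phi_sum z_def
      by (simp only: phi(3) assms(2) Rats_of_int)
  qed
  obtain d :: int where d: "d > 0" "\<And>x. x \<in> X \<Longrightarrow> of_int d * z x \<in> \<int>"
    by (rule common_denominator[OF fin, of z]) (auto simp: z_def phi)
  have "l ^ k * (of_int d * z x) \<in> \<int>" if "x \<in> X" for k x
    using that
  proof (induction k arbitrary: x)
    case 0 then show ?case using d by simp
  next
    case (Suc k)
    have "l ^ Suc k * (of_int d * z x) = l ^ k * of_int d * (l * z x)" by simp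
    also have "\<dots> = (\<Sum>y\<in>X. of_int (K x y) * (l ^ k * (of_int d * z y)))"
      by (simp add: z[OF Suc.prems, symmetric] sum_distrib_left mult_ac)
    also have "\<dots> \<in> \<int>" using Suc by (intro Ints_sum Ints_mult[OF Ints_of_int]) blast
    finally show ?case .
  qed
  from this[OF x0(1)] have "of_int d * l ^ k \<in> \<int>" for k
    using x0 phi(4) by (simp add: z_def mult.commute)
  then show ?thesis using bounded_denominator_powers_imp_int assms(2) d(1) by blast
qed

text \<open>The Kronecker product of the matrices acts factor by factor on the tensor product of the
  eigenvectors.\<close>

lemma int_eigen_mult:
  assumes "int_eigen X K l u" "int_eigen Y M m w"
  shows "int_eigen (X \<times> Y) (\<lambda>(x, y) (x', y'). K x x' * M y y') (l * m) (\<lambda>(x, y). u x * w y)"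
proof -
  have "(\<Sum>(x', y')\<in>X \<times> Y. of_int (K x x' * M y y') * (u x' * w y')) = of_real (l * m) * (u x * w y)"
    if "x \<in> X" "y \<in> Y" for x y
  proof -
    have "(\<Sum>(x', y')\<in>X \<times> Y. of_int (K x x' * M y y') * (u x' * w y'))
        = (\<Sum>x'\<in>X. of_int (K x x') * u x') * (\<Sum>y'\<in>Y. of_int (M y y') * w y')"
      by (simp add: sum_product sum.cartesian_product mult_ac)
    then show ?thesis using assms that by (simp add: int_eigen_def)
  qed
  then show ?thesis using assms by (auto simp: int_eigen_def case_prod_unfold)
qed

text \<open>The matrix is the Kronecker sum: \<open>K\<close> tensor identity plus identity tensor
  \<open>M\<close>.\<close>

lemma int_eigen_add:
  assumes "int_eigen X K l u" "int_eigen Y M m w"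
  shows "int_eigen (X \<times> Y)
    (\<lambda>(x, y) (x', y'). (if y' = y then K x x' else 0) + (if x' = x then M y y' else 0))
    (l + m) (\<lambda>(x, y). u x * w y)"
proof -
  have fin: "finite X" "finite Y" using assms by (auto simp: int_eigen_def)
  have "(\<Sum>(x', y')\<in>X \<times> Y. of_int ((if y' = y then K x x' else 0) + (if x' = x then M y y' else 0)) * (u x' * w y'))
      = of_real (l + m) * (u x * w y)" (is "?L = _")
    if "x \<in> X" "y \<in> Y" for x y
  proof -
    have "?L = (\<Sum>x'\<in>X. \<Sum>y'\<in>Y. if y' = y then of_int (K x x') * (u x' * w y') else 0)
        + (\<Sum>x'\<in>X. \<Sum>y'\<in>Y. if x' = x then of_int (M y y') * (u x' * w y') else 0)"
      by (simp add: sum.cartesian_product[symmetric] sum.distrib[symmetric])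
         (intro sum.cong; simp add: distrib_right)
    also have "(\<Sum>x'\<in>X. \<Sum>y'\<in>Y. if x' = x then of_int (M y y') * (u x' * w y') else 0)
      = (\<Sum>y'\<in>Y. \<Sum>x'\<in>X. if x' = x then of_int (M y y') * (u x' * w y') else 0)"
      by (rule sum.swap)
    also have "(\<Sum>x'\<in>X. \<Sum>y'\<in>Y. if y' = y then of_int (K x x') * (u x' * w y') else 0) =
       (\<Sum>x'\<in>X. of_int (K x x') * u x') * w y"
      using fin that by (simp add: sum_distrib_right mult.assoc)
    also have "(\<Sum>y'\<in>Y. \<Sum>x'\<in>X. if x' = x then of_int (M y y') * (u x' * w y') else 0) =
       u x * (\<Sum>y'\<in>Y. of_int (M y y') * w y')"
      using fin that by (simp add: sum_distrib_left mult.left_commute)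
    finally show ?thesis using assms that by (simp add: int_eigen_def algebra_simps)
  qed
  then show ?thesis using assms by (auto simp: int_eigen_def case_prod_unfold cong: if_cong)
qed

section \<open>Spectral decomposition and rationality\<close>

lemma linear_dependence:
  fixes a :: "'i \<Rightarrow> 'a \<Rightarrow> complex"
  assumes "finite X" "finite I" "card I > card X"
  shows "\<exists>c. (\<exists>i\<in>I. c i \<noteq> 0) \<and> (\<forall>x\<in>X. (\<Sum>i\<in>I. c i * a i x) = 0)"
  using assms
proof (induction X arbitrary: I a)
  case empty
  then obtain i where "i \<in> I" by (metis card_gt_0_iff card.empty ex_in_conv)
  then show ?case by (auto intro!: exI[of _ "\<lambda>_. 1"])
next
  case (insert x X)
  show ?case
  proof (cases "\<forall>i\<in>I. a i x = 0")
    case True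
    obtain c where "\<exists>i\<in>I. c i \<noteq> 0" "\<forall>x\<in>X. (\<Sum>i\<in>I. c i * a i x) = 0"
      using insert.IH[of I a] insert.prems insert.hyps by auto
    then show ?thesis using True by (intro exI[of _ c]) auto
  next
    case False
    then obtain j where j: "j \<in> I" "a j x \<noteq> 0" by blast
    \<comment> \<open>Gaussian elimination of coordinate \<open>x\<close> with pivot
      \<open>a j\<close>. A relation among the \<open>b i\<close> lifts to the \<open>a i\<close>
      once \<open>a j\<close> receives the coefficient \<open>- s\<close> below.\<close>
    define b where "b i y = a i y - a i x / a j x * a j y" for i y
    have "card (I - {j}) > card X" using insert j by simp
    then obtain c where c: "\<exists>i\<in>I - {j}. c i \<noteq> 0" "\<forall>y\<in>X. (\<Sum>i\<in>I - {j}. c i * b i y) = 0"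
      using insert.IH[of "I - {j}" b] insert.prems by auto
    define s where "s = (\<Sum>i\<in>I - {j}. c i * a i x) / a j x"
    define c' where "c' = c(j := - s)"
    have eq: "(\<Sum>i\<in>I. c' i * a i y) = (\<Sum>i\<in>I - {j}. c i * b i y)" for y
    proof -
      have "(\<Sum>i\<in>I. c' i * a i y) = c' j * a j y + (\<Sum>i\<in>I - {j}. c' i * a i y)"
        using j insert.prems by (intro sum.remove) auto
      also have "(\<Sum>i\<in>I - {j}. c' i * a i y) = (\<Sum>i\<in>I - {j}. c i * a i y)"
        by (intro sum.cong) (auto simp: c'_def)
      finally have "(\<Sum>i\<in>I. c' i * a i y) = (\<Sum>i\<in>I - {j}. c i * a i y) - s * a j y"
        by (simp add: c'_def)
      also have "\<dots> = (\<Sum>i\<in>I - {j}. c i * b i y)"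
        by (simp add: s_def b_def sum_subtractf sum_distrib_left sum_distrib_right
            sum_divide_distrib right_diff_distrib mult_ac)
      finally show ?thesis .
    qed
    have "(\<Sum>i\<in>I. c' i * a i y) = 0" if "y \<in> insert x X" for y
    proof (cases "y = x")
      case True
      then have "b i y = 0" for i using j by (simp add: b_def)
      then show ?thesis by (simp add: eq)
    qed (use that eq c in auto)
    moreover have "\<exists>i\<in>I. c' i \<noteq> 0" using c by (auto simp: c'_def)
    ultimately show ?thesis by blast
  qed
qed

text \<open>Newton's scheme: a multiple of the polynomial vanishing on the old nodes corrects the
  value at the new one. The alternative \<open>g = 0\<close> covers empty \<open>S\<close>, where no
  degree is below the cardinality.\<close>

lemma interpolation:
  fixes val :: "'a :: field \<Rightarrow> 'a"
  assumes "finite S"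
  shows "\<exists>g. (g = 0 \<or> degree g < card S) \<and> (\<forall>s\<in>S. poly g s = val s)"
  using assms
proof (induction S)
  case (insert t S)
  then obtain g where g: "g = 0 \<or> degree g < card S" "\<forall>s\<in>S. poly g s = val s" by blast
  define P where "P = (\<Prod>s\<in>S. [:- s, 1:])"
  have P: "poly P t \<noteq> 0" "\<forall>s\<in>S. poly P s = 0" "degree P = card S"
    using insert by (auto simp: P_def poly_prod degree_prod_sum_eq)
  define h where "h = g + smult ((val t - poly g t) / poly P t) P"
  have "degree h \<le> card S" unfolding h_def
    using g(1) P(3) by (intro degree_add_le) (auto intro: order_trans[OF degree_smult_le])
  then show ?case using insert P g
    by (intro exI[of _ h]) (auto simp: h_def)
qed simp

section \<open>Spectral theory of a symmetric integer matrix\<close>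

locale int_sym_matrix =
  fixes X :: "'a set" and K :: "'a \<Rightarrow> 'a \<Rightarrow> int"
  assumes finite_X: "finite X" and sym: "\<And>x y. K x y = K y x"
begin

definition act :: "('a \<Rightarrow> complex) \<Rightarrow> 'a \<Rightarrow> complex" where
  "act f x = (if x \<in> X then \<Sum>y\<in>X. of_int (K x y) * f y else 0)"

definition eig :: "complex \<Rightarrow> ('a \<Rightarrow> complex) \<Rightarrow> bool" where
  "eig l u \<longleftrightarrow> (\<forall>x. x \<notin> X \<longrightarrow> u x = 0) \<and> (\<forall>x. act u x = l * u x)"

definition pact :: "complex poly \<Rightarrow> ('a \<Rightarrow> complex) \<Rightarrow> 'a \<Rightarrow> complex" where
  "pact P f x = (\<Sum>i\<le>degree P. coeff P i * (act ^^ i) f x)"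

lemma act_sum: "act (\<lambda>x. \<Sum>i\<in>I. c i * g i x) x = (\<Sum>i\<in>I. c i * act (g i) x)"
proof -
  have "(\<Sum>y\<in>X. of_int (K x y) * (\<Sum>i\<in>I. c i * g i y)) =
      (\<Sum>y\<in>X. \<Sum>i\<in>I. c i * (of_int (K x y) * g i y))"
    by (simp add: sum_distrib_left mult.left_commute)
  also have "\<dots> = (\<Sum>i\<in>I. \<Sum>y\<in>X. c i * (of_int (K x y) * g i y))" by (rule sum.swap)
  finally show ?thesis by (simp add: act_def sum_distrib_left)
qed

lemma act_lin: "act (\<lambda>x. a * f x + b * g x) x = a * act f x + b * act g x"
  by (simp add: act_def distrib_left sum.distrib sum_distrib_left mult.left_commute)

text \<open>The pairing is bilinear, without conjugation. Since the matrix is real, the Hermitian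
  version follows by inserting \<open>cnj\<close> through \<open>act_cnj\<close>.\<close>

lemma act_adjoint: "(\<Sum>x\<in>X. act f x * g x) = (\<Sum>x\<in>X. f x * act g x)"
proof -
  have "(\<Sum>x\<in>X. act f x * g x) = (\<Sum>x\<in>X. \<Sum>y\<in>X. of_int (K x y) * f y * g x)"
    by (simp add: act_def sum_distrib_right)
  also have "\<dots> = (\<Sum>y\<in>X. \<Sum>x\<in>X. of_int (K x y) * f y * g x)" by (rule sum.swap)
  also have "\<dots> = (\<Sum>x\<in>X. f x * act g x)"
    by (simp add: act_def sum_distrib_left sym mult_ac)
  finally show ?thesis .
qed

lemma act_cnj: "act (\<lambda>x. cnj (f x)) x = cnj (act f x)"
  by (simp add: act_def)

lemma act_outside: "x \<notin> X \<Longrightarrow> act f x = 0"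
  by (simp add: act_def)

lemma sum_cnj_eq_0D:
  fixes u :: "'a \<Rightarrow> complex"
  assumes "(\<Sum>x\<in>X. u x * cnj (u x)) = 0" "x \<in> X"
  shows "u x = 0"
proof -
  have "complex_of_real (\<Sum>x\<in>X. (cmod (u x))\<^sup>2) = 0"
    using assms by (simp add: complex_norm_square del: of_real_power)
  then have "(\<Sum>x\<in>X. (cmod (u x))\<^sup>2) = 0" by (simp only: of_real_eq_0_iff)
  then show ?thesis using assms finite_X by (simp add: sum_nonneg_eq_0_iff)
qed

lemma eig_real:
  assumes "eig l u" "u x \<noteq> 0"
  shows "l \<in> \<real>"
proof -
  have x: "x \<in> X" using assms by (auto simp: eig_def)
  have "(\<Sum>x\<in>X. act u x * cnj (u x)) = (\<Sum>x\<in>X. u x * act (\<lambda>x. cnj (u x)) x)"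
    by (rule act_adjoint)
  then have "(\<Sum>x\<in>X. l * (u x * cnj (u x))) = (\<Sum>x\<in>X. cnj l * (u x * cnj (u x)))"
    using assms by (simp add: eig_def act_cnj mult_ac)
  then have "(l - cnj l) * (\<Sum>x\<in>X. u x * cnj (u x)) = 0"
    by (simp add: sum_distrib_left[symmetric] algebra_simps)
  then have "l = cnj l" using sum_cnj_eq_0D[of u x] assms x by auto
  then show ?thesis by (simp add: Reals_cnj_iff)
qed

lemma eig_orth:
  assumes "eig l u" "eig m w" "l \<noteq> m"
  shows "(\<Sum>x\<in>X. u x * w x) = 0"
proof -
  have "(\<Sum>x\<in>X. act u x * w x) = (\<Sum>x\<in>X. u x * act w x)" by (rule act_adjoint)
  then have "(\<Sum>x\<in>X. l * (u x * w x)) = (\<Sum>x\<in>X. m * (u x * w x))"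
    using assms by (simp add: eig_def mult_ac)
  then have "(l - m) * (\<Sum>x\<in>X. u x * w x) = 0"
    by (simp add: sum_distrib_left[symmetric] algebra_simps)
  then show ?thesis using assms by simp
qed

text \<open>There are no Jordan blocks: with \<open>k = (K - l) h\<close> and
  \<open>(K - l) k = 0\<close>, self-adjointness moves \<open>K - l\<close> from \<open>h\<close> to
  \<open>k\<close>, so the squared norm of \<open>k\<close> is zero.\<close>

lemma act_shift_square:
  assumes "l \<in> \<real>" "\<And>x. act h x - l * h x = k x" "\<And>x. x \<in> X \<Longrightarrow> act k x = l * k x" "x \<in> X"
  shows "k x = 0"
proof -
  have "(\<Sum>x\<in>X. act h x * cnj (k x)) = (\<Sum>x\<in>X. h x * act (\<lambda>x. cnj (k x)) x)"
    by (rule act_adjoint)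
  also have "\<dots> = (\<Sum>x\<in>X. l * h x * cnj (k x))"
    using assms(1,3) by (simp add: act_cnj Reals_cnj_iff mult_ac)
  finally have "(\<Sum>x\<in>X. (act h x - l * h x) * cnj (k x)) = 0"
    by (simp add: left_diff_distrib sum_subtractf)
  then show ?thesis using sum_cnj_eq_0D[of k x] assms by simp
qed

lemma pact_bound:
  assumes "degree P \<le> n"
  shows "pact P f x = (\<Sum>i\<le>n. coeff P i * (act ^^ i) f x)"
  unfolding pact_def using assms
  by (intro sum.mono_neutral_left) (auto simp: coeff_eq_0)

lemma pact_add: "pact (P + Q) f x = pact P f x + pact Q f x"
proof -
  define n where "n = max (degree P) (degree Q)"
  have "degree P \<le> n" "degree Q \<le> n" "degree (P + Q) \<le> n"
    by (auto simp: n_def degree_add_le_max)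
  then show ?thesis by (simp add: pact_bound distrib_right sum.distrib)
qed

lemma pact_smult: "pact (smult c P) f x = c * pact P f x"
  by (simp add: pact_bound[OF degree_smult_le] pact_def sum_distrib_left mult_ac)

lemma pact_pCons0: "pact (pCons 0 P) f x = act (pact P f) x"
proof -
  have "pact (pCons 0 P) f x = (\<Sum>i\<le>Suc (degree P). coeff (pCons 0 P) i * (act ^^ i) f x)"
    by (intro pact_bound degree_pCons_le)
  also have "\<dots> = (\<Sum>i\<le>degree P. coeff P i * act ((act ^^ i) f) x)"
    by (subst sum.atMost_Suc_shift) simp
  also have "\<dots> = act (\<lambda>x. \<Sum>i\<le>degree P. coeff P i * (act ^^ i) f x) x" by (simp add: act_sum)
  finally show ?thesis by (simp add: pact_def[abs_def])
qed

lemma pact_linear_factor: "pact ([:- l, 1:] * P) f x = act (pact P f) x - l * pact P f x"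
  by (simp add: pact_add pact_smult pact_pCons0 diff_conv_add_uminus del: add_uminus_conv_diff flip: smult_minus_left)

lemma act_pow_lin: "(act ^^ i) (\<lambda>x. a * f x + b * g x) x = a * (act ^^ i) f x + b * (act ^^ i) g x"
proof (induction i arbitrary: x)
  case (Suc i)
  have "(act ^^ i) (\<lambda>x. a * f x + b * g x) = (\<lambda>x. a * (act ^^ i) f x + b * (act ^^ i) g x)"
    using Suc by blast
  then show ?case by (simp add: act_lin)
qed simp

lemma pact_lin: "pact P (\<lambda>x. a * f x + b * g x) x = a * pact P f x + b * pact P g x"
  by (simp add: pact_def act_pow_lin distrib_left sum.distrib sum_distrib_left mult_ac)

lemma act_pow_outside: "(\<And>x. x \<notin> X \<Longrightarrow> f x = 0) \<Longrightarrow> x \<notin> X \<Longrightarrow> (act ^^ i) f x = 0"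
  by (cases i) (auto simp: act_outside)

lemma pact_outside: "(\<And>x. x \<notin> X \<Longrightarrow> f x = 0) \<Longrightarrow> x \<notin> X \<Longrightarrow> pact P f x = 0"
  by (simp add: pact_def act_pow_outside)

lemma act_pow_eig: "eig l u \<Longrightarrow> (act ^^ i) u x = l ^ i * u x"
proof (induction i arbitrary: x)
  case (Suc i)
  then have "(act ^^ i) u = (\<lambda>x. l ^ i * u x + 0 * u x)" by auto
  then show ?case using Suc.prems by (simp only: funpow.simps comp_apply act_lin) (simp add: eig_def)
qed simp

lemma pact_eig: "eig l u \<Longrightarrow> pact P u x = poly P l * u x"
  by (simp add: pact_def act_pow_eig poly_altdef sum_distrib_right mult.assoc)

text \<open>The Krylov vectors \<open>f\<close>, \<open>K f\<close>, and so on up to the power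
  \<open>card X\<close> are one more than the dimension, hence dependent.\<close>

lemma annihilator_exists:
  assumes "\<And>x. x \<notin> X \<Longrightarrow> f x = 0"
  shows "\<exists>P. P \<noteq> 0 \<and> (\<forall>x. pact P f x = 0)"
proof -
  obtain c where c: "\<exists>i\<in>{..card X}. c i \<noteq> 0"
    "\<forall>x\<in>X. (\<Sum>i\<in>{..card X}. c i * (act ^^ i) f x) = 0"
    using linear_dependence[OF finite_X, of "{..card X}" "\<lambda>i. (act ^^ i) f"] by auto
  define P where "P = (\<Sum>i\<le>card X. monom (c i) i)"
  have cf: "coeff P j = (if j \<le> card X then c j else 0)" for j
    by (simp add: P_def coeff_sum coeff_monom)
  then have "degree P \<le> card X" by (intro degree_le) auto
  then have "pact P f x = (\<Sum>i\<le>card X. c i * (act ^^ i) f x)" for x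
    by (simp add: pact_bound cf)
  then have "pact P f x = 0" for x
    using c(2) assms by (cases "x \<in> X") (auto simp: act_pow_outside)
  moreover have "P \<noteq> 0" using c(1) cf by (metis atMost_iff coeff_0)
  ultimately show ?thesis by blast
qed

text \<open>Split off a root \<open>l\<close> of the annihilator, \<open>P = (x - l) Q\<close>. Then
  \<open>Q(K) f\<close> is an eigenvector for \<open>l\<close>, and subtracting a suitable multiple
  of it from \<open>f\<close> leaves a vector annihilated by \<open>Q\<close>.\<close>

lemma decomposition_from_annihilator:
  assumes "P \<noteq> 0" "\<And>x. pact P f x = 0" "\<And>x. x \<notin> X \<Longrightarrow> f x = 0"
  shows "\<exists>S h. finite S \<and> (\<forall>l\<in>S. eig l (h l)) \<and> (\<forall>x. f x = (\<Sum>l\<in>S. h l x))"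
  using assms
proof (induction "degree P" arbitrary: P f)
  case 0
  then obtain c where "P = [:c:]" "c \<noteq> 0" by (metis degree_eq_zeroE pCons_0_0)
  then have "f x = 0" for x using 0(3)[of x] by (simp add: pact_def)
  then show ?case by (intro exI[of _ "{}"]) auto
next
  case (Suc n)
  have "\<not> constant (poly P)" using Suc.hyps by (simp add: constant_degree)
  then obtain l where "poly P l = 0" using fundamental_theorem_of_algebra by blast
  then obtain Q where Q: "P = [:- l, 1:] * Q" by (metis dvdE poly_eq_0_iff_dvd)
  have Q0: "Q \<noteq> 0" using Q Suc.prems by auto
  then have degQ: "degree Q = n" using Suc.hyps unfolding Q by (subst (asm) degree_mult_eq) auto
  define h where "h = pact Q f"
  have eigh: "eig l h"
    using Suc.prems(2,3) unfolding Q pact_linear_factor by (auto simp: eig_def h_def pact_outside)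
  show ?case
  proof (cases "\<forall>x. h x = 0")
    case True
    then show ?thesis using Suc.hyps(1)[of Q f] degQ Q0 Suc.prems(3) by (auto simp: h_def)
  next
    case False
    then have lr: "l \<in> \<real>" using eig_real eigh by blast
    have "poly Q l \<noteq> 0"
    proof
      \<comment> \<open>A double root would write \<open>h\<close> as \<open>K - l\<close> applied
        to another vector, and \<open>act_shift_square\<close> would make it vanish.\<close>
      assume "poly Q l = 0"
      then obtain Q2 where Q2: "Q = [:- l, 1:] * Q2" by (metis dvdE poly_eq_0_iff_dvd)
      have "h x = 0" for x
      proof (cases "x \<in> X")
        case True
        show ?thesis
          by (rule act_shift_square[of l "pact Q2 f" h, OF lr _ _ True])
             (use eigh in \<open>auto simp: eig_def h_def Q2 pact_linear_factor simp del: mult_pCons_left\<close>)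
      qed (use eigh in \<open>auto simp: eig_def\<close>)
      then show False using False by blast
    qed
    \<comment> \<open>\<open>Q(K)\<close> multiplies the eigenvector \<open>h\<close> by
      \<open>poly Q l\<close>, so this multiple of \<open>h\<close> cancels
      \<open>Q(K) f = h\<close>.\<close>
    define f' where "f' x = 1 * f x + (- 1 / poly Q l) * h x" for x
    have "pact Q f' x = 0" for x
      unfolding f'_def[abs_def] pact_lin pact_eig[OF eigh] using \<open>poly Q l \<noteq> 0\<close> by (simp add: h_def)
    moreover have "f' x = 0" if "x \<notin> X" for x
      using that Suc.prems(3) eigh by (auto simp: f'_def eig_def)
    ultimately obtain S g where S: "finite S" "\<forall>l\<in>S. eig l (g l)" "\<forall>x. f' x = (\<Sum>l\<in>S. g l x)"
      using Suc.hyps(1)[of Q f'] degQ Q0 by auto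
    \<comment> \<open>The inductive decomposition may already contain a component for
      \<open>l\<close>; it is merged with the new one.\<close>
    define g0 where "g0 = (if l \<in> S then g l else (\<lambda>x. 0))"
    have eg0: "eig l g0" using S(2) by (auto simp: g0_def eig_def act_def)
    define g' where "g' = g(l := (\<lambda>x. 1 * g0 x + (1 / poly Q l) * h x))"
    have "eig l (\<lambda>x. 1 * g0 x + (1 / poly Q l) * h x)"
      unfolding eig_def act_lin using eg0 eigh by (auto simp: eig_def algebra_simps)
    then have "\<forall>k\<in>insert l S. eig k (g' k)" using S(2) by (auto simp: g'_def)
    moreover have "f x = (\<Sum>k\<in>insert l S. g' k x)" for x
    proof -
      have "(\<Sum>k\<in>insert l S. g' k x) = g' l x + (\<Sum>k\<in>S - {l}. g' k x)"
        using S(1) by (simp add: sum.insert_remove)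
      also have "(\<Sum>k\<in>S - {l}. g' k x) = (\<Sum>k\<in>S - {l}. g k x)"
        by (intro sum.cong) (auto simp: g'_def)
      also have "g' l x + \<dots> = h x / poly Q l + (g0 x + (\<Sum>k\<in>S - {l}. g k x))"
        by (simp add: g'_def)
      also have "g0 x + (\<Sum>k\<in>S - {l}. g k x) = f' x"
        using S(1,3) by (auto simp: g0_def sum.remove)
      finally show ?thesis by (simp add: f'_def)
    qed
    ultimately show ?thesis using S(1) by (intro exI[of _ "insert l S"] exI[of _ g']) auto
  qed
qed

text \<open>Requiring nonzero components makes \<open>S\<close> the eigenvalue support of
  \<open>f\<close> and makes the components independent.\<close>

definition spectral_decomposition :: "real set \<Rightarrow> (real \<Rightarrow> 'a \<Rightarrow> complex) \<Rightarrow> ('a \<Rightarrow> complex) \<Rightarrow> bool" where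
  "spectral_decomposition S h f \<longleftrightarrow> finite S \<and>
     (\<forall>l\<in>S. eig (of_real l) (h l) \<and> (\<exists>x\<in>X. h l x \<noteq> 0)) \<and> (\<forall>x. f x = (\<Sum>l\<in>S. h l x))"

lemma spectral_decomposition_exists:
  assumes "\<And>x. x \<notin> X \<Longrightarrow> f x = 0"
  shows "\<exists>S h. spectral_decomposition S h f"
proof -
  obtain P where P: "P \<noteq> 0" "\<And>x. pact P f x = 0"
    using annihilator_exists[of f] assms by blast
  obtain T h where T: "finite T" "\<forall>l\<in>T. eig l (h l)" "\<forall>x. f x = (\<Sum>l\<in>T. h l x)"
    using decomposition_from_annihilator[OF P assms] by blast
  \<comment> \<open>Zero components are dropped; the others have real eigenvalues by
    \<open>eig_real\<close>, so the index set can be real.\<close>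
  define S where "S = {l. complex_of_real l \<in> T \<and> (\<exists>x. h (of_real l) x \<noteq> 0)}"
  have T': "of_real ` S = {l\<in>T. \<exists>x. h l x \<noteq> 0}"
  proof (intro equalityI subsetI)
    fix l assume l: "l \<in> {l\<in>T. \<exists>x. h l x \<noteq> 0}"
    then have "l \<in> \<real>" using T(2) eig_real by blast
    then show "l \<in> of_real ` S" using l by (auto simp: S_def elim!: Reals_cases)
  qed (auto simp: S_def)
  have "finite (complex_of_real ` S)" using T(1) T' by simp
  then have fin: "finite S" by (rule finite_imageD) (simp add: inj_on_def)
  have "f x = (\<Sum>l\<in>S. h (of_real l) x)" for x
  proof -
    have "f x = (\<Sum>l\<in>complex_of_real ` S. h l x)"
      unfolding T' using T(1,3) by (simp only:) (intro sum.mono_neutral_right; auto)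
    also have "\<dots> = (\<Sum>l\<in>S. h (of_real l) x)"
      by (subst sum.reindex) (auto simp: inj_on_def)
    finally show ?thesis .
  qed
  moreover have "\<exists>x\<in>X. h (of_real l) x \<noteq> 0" if "l \<in> S" for l
    using that T(2) by (auto simp: S_def eig_def)
  ultimately show ?thesis using fin T(2)
    by (intro exI[of _ S] exI[of _ "\<lambda>l. h (of_real l)"]) (auto simp: spectral_decomposition_def S_def)
qed

lemma act_pow_decomposition:
  assumes "spectral_decomposition S h f"
  shows "(act ^^ k) f x = (\<Sum>l\<in>S. of_real l ^ k * h l x)"
proof (induction k arbitrary: x)
  case 0 then show ?case using assms by (simp add: spectral_decomposition_def)
next
  case (Suc k)
  then have "(act ^^ k) f = (\<lambda>x. \<Sum>l\<in>S. of_real l ^ k * h l x)" by blast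
  then have "(act ^^ Suc k) f x = (\<Sum>l\<in>S. of_real l ^ k * act (h l) x)" by (simp add: act_sum)
  also have "\<dots> = (\<Sum>l\<in>S. of_real l ^ Suc k * h l x)"
    using assms by (intro sum.cong) (auto simp: spectral_decomposition_def eig_def)
  finally show ?case .
qed

lemma pact_decomposition:
  assumes "spectral_decomposition S h f"
  shows "pact P f x = (\<Sum>l\<in>S. poly P (of_real l) * h l x)"
proof -
  have "pact P f x = (\<Sum>i\<le>degree P. \<Sum>l\<in>S. coeff P i * of_real l ^ i * h l x)"
    by (simp add: pact_def act_pow_decomposition[OF assms] sum_distrib_left mult_ac)
  also have "\<dots> = (\<Sum>l\<in>S. \<Sum>i\<le>degree P. coeff P i * of_real l ^ i * h l x)" by (rule sum.swap)
  finally show ?thesis by (simp add: poly_altdef sum_distrib_right)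
qed

text \<open>Pairing with the conjugate of \<open>h m\<close>, again an eigenvector for the real
  number \<open>m\<close>, kills every other component and leaves \<open>c m\<close> times a
  positive squared norm.\<close>

lemma decomposition_independent:
  assumes "spectral_decomposition S h f" "\<And>x. x \<in> X \<Longrightarrow> (\<Sum>l\<in>S. c l * h l x) = 0" "m \<in> S"
  shows "c m = 0"
proof -
  have fin: "finite S" and e: "\<And>l. l \<in> S \<Longrightarrow> eig (of_real l) (h l)"
    using assms(1) by (auto simp: spectral_decomposition_def)
  have em: "eig (of_real m) (\<lambda>x. cnj (h m x))"
    using e[OF assms(3)] by (auto simp: eig_def act_cnj)
  have "0 = (\<Sum>x\<in>X. (\<Sum>l\<in>S. c l * h l x) * cnj (h m x))" using assms(2) by simp
  also have "\<dots> = (\<Sum>x\<in>X. \<Sum>l\<in>S. c l * (h l x * cnj (h m x)))"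
    by (simp add: sum_distrib_right mult.assoc)
  also have "\<dots> = (\<Sum>l\<in>S. \<Sum>x\<in>X. c l * (h l x * cnj (h m x)))" by (rule sum.swap)
  also have "\<dots> = (\<Sum>l\<in>S. if l = m then c m * (\<Sum>x\<in>X. h m x * cnj (h m x)) else 0)"
    using eig_orth[OF e em] by (intro sum.cong) (auto simp: sum_distrib_left[symmetric])
  also have "\<dots> = c m * (\<Sum>x\<in>X. h m x * cnj (h m x))" using fin assms(3) by simp
  finally have "c m = 0 \<or> (\<Sum>x\<in>X. h m x * cnj (h m x)) = 0" by simp
  moreover obtain x where "x \<in> X" "h m x \<noteq> 0"
    using assms(1,3) by (auto simp: spectral_decomposition_def)
  ultimately show ?thesis using sum_cnj_eq_0D[of "h m" x] by blast
qed

lemma act_pow_rational: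
  assumes "\<And>x. f x \<in> of_real ` \<rat>"
  shows "(act ^^ k) f x \<in> of_real ` \<rat>"
proof (induction k arbitrary: x)
  case 0 then show ?case using assms by simp
next
  case (Suc k)
  have "\<forall>y. \<exists>q\<in>\<rat>. (act ^^ k) f y = of_real q" using Suc by auto
  then obtain q where q: "\<And>y. q y \<in> \<rat>" "\<And>y. (act ^^ k) f y = of_real (q y)" by metis
  have "(act ^^ Suc k) f x = of_real (if x \<in> X then \<Sum>y\<in>X. of_int (K x y) * q y else 0)"
    by (simp add: act_def q)
  moreover have "(if x \<in> X then \<Sum>y\<in>X. of_int (K x y) * q y else 0) \<in> \<rat>"
    using q by (auto intro!: Rats_sum)
  ultimately show ?case by blast
qed

text \<open>Replacing the coefficients of the interpolation polynomial by their images under a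
  rational-linear functional does not change its action on the rational vector \<open>f\<close>, so by
  independence of the components it does not change its values on \<open>S\<close>.\<close>

lemma rational_interpolation:
  assumes sd: "spectral_decomposition S h f" and f: "\<And>x. f x \<in> of_real ` \<rat>"
    and w: "\<And>x. x \<in> X \<Longrightarrow> (\<Sum>l\<in>S. val l * h l x) \<in> of_real ` \<rat>"
  shows "\<exists>G :: real poly. (\<forall>i. coeff G i \<in> \<rat>) \<and> (G = 0 \<or> degree G < card S) \<and>
     (\<forall>l\<in>S. of_real (poly G l) = val l)"
proof -
  have fin: "finite S" using sd by (simp add: spectral_decomposition_def)
  have card_img: "card (complex_of_real ` S) = card S" by (intro card_image) (auto simp: inj_on_def)
  obtain g where g: "g = 0 \<or> degree g < card S" "\<And>l. l \<in> S \<Longrightarrow> poly g (complex_of_real l) = val l"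
    using interpolation[of "complex_of_real ` S" "\<lambda>z. val (Re z)"] fin card_img by auto
  obtain \<phi> where phi: "\<And>x y. \<phi> (x + y) = \<phi> x + \<phi> y" "\<And>x. \<phi> x \<in> \<rat>"
    "\<And>q x. q \<in> \<rat> \<Longrightarrow> \<phi> (complex_of_real q * x) = q * \<phi> x" "\<phi> 1 = 1"
    by (rule rational_functional) (assumption | blast)+
  have phi0: "\<phi> 0 = 0" using phi(1)[of 0 0] by simp
  have phi_sum: "\<phi> (\<Sum>y\<in>Y. F y) = (\<Sum>y\<in>Y. \<phi> (F y))" for F and Y :: "nat set"
    using phi0 by (induction Y rule: infinite_finite_induct) (auto simp: phi(1))
  have phiq: "of_real (\<phi> z) = z" if "z \<in> complex_of_real ` \<rat>" for z
    using that phi(3)[of _ 1] phi(4) by auto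
  define G where "G = map_poly \<phi> g"
  define g' where "g' = map_poly complex_of_real G"
  have cG: "coeff G i = \<phi> (coeff g i)" for i by (simp add: G_def coeff_map_poly phi0)
  have cg': "coeff g' i = of_real (\<phi> (coeff g i))" for i by (simp add: g'_def coeff_map_poly cG)
  have pg': "poly g' (of_real l) = of_real (poly G l)" for l
    unfolding g'_def by (induction G) (auto simp: map_poly_pCons)
  have dG: "degree G \<le> degree g" unfolding G_def by (rule map_poly_degree_leq)
  have dg': "degree g' \<le> degree g" using dG map_poly_degree_leq[of complex_of_real G] by (simp add: g'_def)
  have "pact g' f x = pact g f x" if "x \<in> X" for x
  proof -
    have "\<phi> (pact g f x) = (\<Sum>i\<le>degree g. \<phi> (coeff g i * (act ^^ i) f x))"
      by (simp add: pact_def phi_sum)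
    also have "complex_of_real \<dots> = (\<Sum>i\<le>degree g. coeff g' i * (act ^^ i) f x)"
    proof -
      have "complex_of_real (\<phi> (coeff g i * (act ^^ i) f x)) = coeff g' i * (act ^^ i) f x" for i
      proof -
        obtain q where q: "q \<in> \<rat>" "(act ^^ i) f x = of_real q" using act_pow_rational[of f i x, OF f] by auto
        then show ?thesis using phi(3)[of q "coeff g i"] by (simp add: cg' mult.commute)
      qed
      then show ?thesis by simp
    qed
    also have "\<dots> = pact g' f x" by (simp add: pact_bound[OF dg'])
    finally show ?thesis
      using phiq[of "pact g f x"] w[OF that] g(2) by (simp add: pact_decomposition[OF sd])
  qed
  then have "(\<Sum>l\<in>S. (poly g' (of_real l) - poly g (of_real l)) * h l x) = 0" if "x \<in> X" for x
    using that by (simp add: pact_decomposition[OF sd] left_diff_distrib sum_subtractf)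
  from decomposition_independent[OF sd this] have "of_real (poly G l) = val l" if "l \<in> S" for l
    using that g(2) pg' by auto
  moreover have "G = 0 \<or> degree G < card S" using g(1) dG by (auto simp: G_def)
  ultimately show ?thesis using phi(2) cG by (intro exI[of _ G]) auto
qed

end

text \<open>In the field generated by \<open>\<delta>\<close>, evaluation at the two conjugate
  points gives \<open>A + B * \<delta>\<close> and \<open>A - B * \<delta>\<close> with the same
  rational \<open>A\<close> and \<open>B\<close>. A zero forces \<open>B = 0\<close>, and then
  \<open>A = 0\<close>.\<close>

lemma rational_poly_quadratic_conjugate:
  fixes G :: "real poly"
  assumes "\<And>i. coeff G i \<in> \<rat>" "c \<in> \<rat>" "q \<in> \<rat>" "\<delta>\<^sup>2 \<in> \<rat>" "\<delta> \<notin> \<rat>" "poly G (c + q * \<delta>) = 0"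
  shows "poly G (c - q * \<delta>) = 0"
proof -
  have "\<exists>A\<in>\<rat>. \<exists>B\<in>\<rat>. poly G (c + q * \<delta>) = A + B * \<delta> \<and> poly G (c - q * \<delta>) = A - B * \<delta>"
    using assms(1)
  proof (induction G)
    case 0 then show ?case by (intro bexI[of _ 0]) auto
  next
    case (pCons a G)
    have "coeff G i \<in> \<rat>" for i using pCons.prems[of "Suc i"] by simp
    then obtain A B where AB: "A \<in> \<rat>" "B \<in> \<rat>" "poly G (c + q * \<delta>) = A + B * \<delta>" "poly G (c - q * \<delta>) = A - B * \<delta>"
      using pCons.IH by blast
    have a: "a \<in> \<rat>" using pCons.prems[of 0] by simp
    show ?case
    proof (rule bexI[of _ "a + c * A + q * B * \<delta>\<^sup>2"], rule bexI[of _ "c * B + q * A"], intro conjI)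
      show "poly (pCons a G) (c + q * \<delta>) = a + c * A + q * B * \<delta>\<^sup>2 + (c * B + q * A) * \<delta>"
        by (simp add: AB(3,4)) (simp add: algebra_simps power2_eq_square)
      show "poly (pCons a G) (c - q * \<delta>) = a + c * A + q * B * \<delta>\<^sup>2 - (c * B + q * A) * \<delta>"
        by (simp add: AB(3,4)) (simp add: algebra_simps power2_eq_square)
    qed (use a AB assms in auto)
  qed
  then obtain A B where AB: "A \<in> \<rat>" "B \<in> \<rat>" "poly G (c + q * \<delta>) = A + B * \<delta>" "poly G (c - q * \<delta>) = A - B * \<delta>"
    by blast
  have "B = 0"
  proof (rule ccontr)
    assume "B \<noteq> 0"
    then have "\<delta> = - A / B" using AB(3) assms(6) by (simp add: field_simps)
    then show False using AB assms(5) by auto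
  qed
  then show ?thesis using AB assms(6) by simp
qed

text \<open>Vieta's formulas, with the second elementary symmetric function expressed through power
  sums, since the sum of squares is what is needed later.\<close>

lemma coeff_prod_linear_factors:
  fixes S :: "real set"
  assumes "finite S"
  shows "coeff (\<Prod>l\<in>S. [:- l, 1:]) (card S) = 1"
    and "i > card S \<Longrightarrow> coeff (\<Prod>l\<in>S. [:- l, 1:]) i = 0"
    and "Suc j = card S \<Longrightarrow> coeff (\<Prod>l\<in>S. [:- l, 1:]) j = - \<Sum>S"
    and "Suc (Suc k) = card S \<Longrightarrow> 2 * coeff (\<Prod>l\<in>S. [:- l, 1:]) k = (\<Sum>S)\<^sup>2 - (\<Sum>l\<in>S. l\<^sup>2)"
  using assms
proof (induction S arbitrary: i j k)
  case (insert t S)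
  {
    case 1 show ?case using insert by simp
  next
    case (2 i) then show ?case using insert by (cases i) auto
  next
    case (3 j) then show ?case using insert.IH insert.hyps
      by (cases j) (auto simp: coeff_pCons split: nat.split)
  next
    case (4 k)
    have "2 * coeff (\<Prod>l\<in>insert t S. [:- l, 1:]) k =
       - t * (2 * coeff (\<Prod>l\<in>S. [:- l, 1:]) k) + (case k of 0 \<Rightarrow> 0 | Suc k' \<Rightarrow> 2 * coeff (\<Prod>l\<in>S. [:- l, 1:]) k')"
      using insert by (simp add: coeff_pCons split: nat.split)
    moreover have "coeff (\<Prod>l\<in>S. [:- l, 1:]) k = - \<Sum>S" using insert 4 by auto
    moreover have "(case k of 0 \<Rightarrow> 0 | Suc k' \<Rightarrow> 2 * coeff (\<Prod>l\<in>S. [:- l, 1:]) k') = (\<Sum>S)\<^sup>2 - (\<Sum>l\<in>S. l\<^sup>2)"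
    proof (cases k)
      \<comment> \<open>Here \<open>S\<close> is a singleton: the coefficient below the constant
        term counts as zero, and the square of the sum equals the sum of squares.\<close>
      case 0
      then have "card S = 1" using 4 insert by simp
      then obtain s where "S = {s}" by (auto simp: card_1_singleton_iff)
      then show ?thesis using 0 by simp
    next
      case (Suc k')
      then show ?thesis using insert 4 by auto
    qed
    ultimately show ?case using insert by (simp add: power2_eq_square algebra_simps)
  }
qed auto

section \<open>Rationality of the eigenvalue support under state transfer\<close>

context int_sym_matrix
begin

text \<open>The \<open>n\<close>-th power of the matrix, \<open>n = card S\<close>, maps
  \<open>v\<close> to a rational vector, so the values \<open>l ^ n\<close> on \<open>S\<close> are
  interpolated by a rational \<open>G\<close> of degree below \<open>n\<close>. The product of
  linear factors must then be \<open>x ^ n - G\<close>.\<close>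

lemma rational_support_poly:
  assumes sd: "spectral_decomposition S h v" and v: "\<And>x. v x \<in> of_real ` \<rat>"
  shows "coeff (\<Prod>l\<in>S. [:- l, 1:]) i \<in> \<rat>"
proof -
  define n where "n = card S"
  have fin: "finite S" using sd by (simp add: spectral_decomposition_def)
  have "\<exists>G :: real poly. (\<forall>i. coeff G i \<in> \<rat>) \<and> (G = 0 \<or> degree G < card S) \<and>
     (\<forall>l\<in>S. complex_of_real (poly G l) = of_real l ^ n)"
    using act_pow_rational[of v n, OF v] act_pow_decomposition[OF sd]
    by (intro rational_interpolation[OF sd v]) auto
  then obtain G :: "real poly" where G: "\<forall>i. coeff G i \<in> \<rat>" "G = 0 \<or> degree G < n"
    "\<And>l. l \<in> S \<Longrightarrow> complex_of_real (poly G l) = of_real l ^ n" by (auto simp: n_def)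
  have Gl: "poly G l = l ^ n" if "l \<in> S" for l
    using G(3)[OF that] by (metis of_real_eq_iff of_real_power)
  define P where "P = (\<Prod>l\<in>S. [:- l, 1:])"
  \<comment> \<open>The leading terms cancel, so \<open>D\<close> has degree below \<open>n\<close>
    but vanishes at the \<open>n\<close> points of \<open>S\<close>.\<close>
  define D where "D = P - monom 1 n + G"
  have D0: "poly D l = 0" if "l \<in> S" for l
    using that fin Gl by (auto simp: D_def P_def poly_prod poly_monom)
  have cD: "coeff D i = 0" if "i \<ge> n" for i
  proof -
    have "coeff G i = 0" using G(2) that by (auto simp: coeff_eq_0)
    then show ?thesis using coeff_prod_linear_factors(1,2)[OF fin] that
      by (cases "i = n") (auto simp: D_def P_def n_def)
  qed
  have "D = 0"
  proof (rule ccontr)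
    assume "D \<noteq> 0"
    then have "degree D < n" using cD by (metis leI leading_coeff_0_iff)
    moreover have "card S \<le> card {x. poly D x = 0}"
      using D0 poly_roots_finite[OF \<open>D \<noteq> 0\<close>] by (intro card_mono) auto
    moreover have "card {x. poly D x = 0} \<le> degree D" using \<open>D \<noteq> 0\<close> by (rule card_poly_roots_bound)
    ultimately show False by (simp add: n_def)
  qed
  then have "P = monom 1 n - G" by (simp add: D_def algebra_simps)
  then have "coeff P i = (if i = n then 1 else 0) - coeff G i" by simp
  then show ?thesis using G(1) by (auto simp: P_def)
qed

lemma transfer_structure:
  assumes sd: "spectral_decomposition S h v" and v: "\<And>x. v x \<in> of_real ` \<rat>"
    and wr: "\<And>x. x \<in> X \<Longrightarrow> w x \<in> of_real ` \<rat>"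
    and \<chi>: "cmod \<chi> = 1"
    and w: "\<And>x. x \<in> X \<Longrightarrow> w x = (\<Sum>l\<in>S. \<chi> * exp (- \<i> * of_real \<tau> * of_real l) * h l x)"
    and ne: "\<exists>x\<in>X. w x \<noteq> v x" "\<exists>x\<in>X. w x \<noteq> - v x"
  shows "\<exists>\<epsilon> :: real \<Rightarrow> real. (\<forall>l\<in>S. \<epsilon> l = 1 \<or> \<epsilon> l = -1) \<and> (\<forall>x\<in>X. w x = (\<Sum>l\<in>S. of_real (\<epsilon> l) * h l x))
     \<and> (\<exists>l\<in>S. \<epsilon> l = 1) \<and> (\<exists>l\<in>S. \<epsilon> l = -1) \<and>
     (S \<subseteq> \<rat> \<or> (\<exists>c \<delta>. c \<in> \<rat> \<and> \<delta> \<notin> \<rat> \<and> \<delta>\<^sup>2 \<in> \<rat> \<and>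
        (\<forall>l\<in>S. \<exists>q\<in>\<rat>. l = c + q * \<delta> \<and> c - q * \<delta> \<in> S \<and> \<epsilon> (c - q * \<delta>) = \<epsilon> l)))"
proof -
  have fin: "finite S" and vx: "\<And>x. v x = (\<Sum>l\<in>S. h l x)"
    using sd by (auto simp: spectral_decomposition_def)
  define \<gamma> where "\<gamma> l = \<chi> * exp (- \<i> * of_real \<tau> * of_real l)" for l :: real
  \<comment> \<open>Interpolation by a real polynomial shows that the phases
    \<open>\<gamma> l\<close> are real; having modulus one, they are signs.\<close>
  have "\<exists>G :: real poly. (\<forall>i. coeff G i \<in> \<rat>) \<and> (G = 0 \<or> degree G < card S) \<and>
     (\<forall>l\<in>S. complex_of_real (poly G l) = \<gamma> l)"
    using wr w by (intro rational_interpolation[OF sd v]) (auto simp: \<gamma>_def)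
  then obtain G :: "real poly" where G: "\<And>i. coeff G i \<in> \<rat>"
    "\<And>l. l \<in> S \<Longrightarrow> complex_of_real (poly G l) = \<gamma> l" by auto
  define \<epsilon> where "\<epsilon> = poly G"
  have pm: "\<epsilon> l = 1 \<or> \<epsilon> l = -1" if "l \<in> S" for l
  proof -
    have "cmod (\<gamma> l) = 1" using \<chi> by (simp add: \<gamma>_def norm_mult)
    then have "\<bar>\<epsilon> l\<bar> = 1" using G(2)[OF that] by (metis norm_of_real \<epsilon>_def)
    then show ?thesis by linarith
  qed
  have w': "w x = (\<Sum>l\<in>S. of_real (\<epsilon> l) * h l x)" if "x \<in> X" for x
    using w[OF that] G(2) by (simp add: \<epsilon>_def \<gamma>_def)
  have e1: "\<exists>l\<in>S. \<epsilon> l = 1"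
  proof (rule ccontr)
    assume "\<not> ?thesis"
    then have "\<forall>l\<in>S. \<epsilon> l = -1" using pm by blast
    then have "w x = - v x" if "x \<in> X" for x using w'[OF that] vx by (simp add: sum_negf)
    then show False using ne by blast
  qed
  have e2: "\<exists>l\<in>S. \<epsilon> l = -1"
  proof (rule ccontr)
    assume "\<not> ?thesis"
    then have "\<forall>l\<in>S. \<epsilon> l = 1" using pm by blast
    then have "w x = v x" if "x \<in> X" for x using w'[OF that] vx by simp
    then show False using ne by blast
  qed
  obtain l1 l2 where l12: "l1 \<in> S" "\<epsilon> l1 = 1" "l2 \<in> S" "\<epsilon> l2 = -1" using e1 e2 by blast
  have "\<tau> \<noteq> 0"
  proof
    assume "\<tau> = 0"
    then have "\<gamma> l1 = \<gamma> l2" by (simp add: \<gamma>_def)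
    then show False using G(2)[OF l12(1)] G(2)[OF l12(3)] l12 by (auto simp: \<epsilon>_def)
  qed
  define d where "d = pi / \<tau>"
  \<comment> \<open>Both phases are real and nonzero, so their quotient is real and the sine of
    \<open>\<tau> * (l - m)\<close> vanishes.\<close>
  have "\<exists>k::int. l - m = of_int k * d" if "l \<in> S" "m \<in> S" for l m
  proof -
    have "of_real (\<epsilon> l) = of_real (\<epsilon> m) * exp (- \<i> * of_real (\<tau> * (l - m)))"
    proof -
      have "of_real (\<epsilon> l) = \<gamma> l" "of_real (\<epsilon> m) = \<gamma> m" using G(2) that by (auto simp: \<epsilon>_def)
      moreover have "\<gamma> l = \<gamma> m * exp (- \<i> * of_real (\<tau> * (l - m)))"
        by (simp add: \<gamma>_def exp_add[symmetric] algebra_simps)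
      ultimately show ?thesis by simp
    qed
    then have "Im (of_real (\<epsilon> l)) = Im (of_real (\<epsilon> m) * exp (- \<i> * of_real (\<tau> * (l - m))))"
      by (rule arg_cong)
    then have "\<epsilon> m * sin (\<tau> * (l - m)) = 0"
      by (simp add: Im_exp)
    then have "sin (\<tau> * (l - m)) = 0" using pm[OF that(2)] by auto
    then obtain i :: int where "\<tau> * (l - m) = of_int i * pi" by (auto simp: sin_zero_iff_int2)
    then show ?thesis using \<open>\<tau> \<noteq> 0\<close> by (intro exI[of _ i]) (simp add: d_def field_simps)
  qed
  then obtain k :: "real \<Rightarrow> real \<Rightarrow> int" where k: "\<And>l m. l \<in> S \<Longrightarrow> m \<in> S \<Longrightarrow> l - m = of_int (k l m) * d"
    by metis
  define n where "n = card S"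
  have n: "n \<ge> 2"
  proof -
    have "card {l1, l2} \<le> n" unfolding n_def using fin l12 by (intro card_mono) auto
    moreover have "l1 \<noteq> l2" using l12 by auto
    ultimately show ?thesis by simp
  qed
  define c where "c = \<Sum>S / n"
  \<comment> \<open>Averaging \<open>l - m\<close> over all \<open>m\<close> in \<open>S\<close>
    gives \<open>l - c\<close>, with \<open>c\<close> the mean of the support.\<close>
  define q where "q l = of_int (\<Sum>m\<in>S. k l m) / real n" for l
  have ql: "l = c + q l * d" if "l \<in> S" for l
  proof -
    have "real n * l - \<Sum>S = (\<Sum>m\<in>S. l - m)" by (simp add: sum_subtractf n_def)
    also have "\<dots> = of_int (\<Sum>m\<in>S. k l m) * d" using k that by (simp add: sum_distrib_right)
    finally have "real n * l - \<Sum>S = of_int (\<Sum>m\<in>S. k l m) * d" .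
    then show ?thesis using n by (simp add: c_def q_def field_simps)
  qed
  define P where "P = (\<Prod>l\<in>S. [:- l, 1:])"
  have P: "coeff P i \<in> \<rat>" for i using rational_support_poly[OF sd v] by (simp add: P_def)
  have s1: "\<Sum>S \<in> \<rat>"
    using P[of "n - 1"] coeff_prod_linear_factors(3)[OF fin, of "n - 1"] n by (simp add: P_def n_def)
  have "(\<Sum>l\<in>S. l\<^sup>2) = (\<Sum>S)\<^sup>2 - 2 * coeff P (n - 2)"
    using coeff_prod_linear_factors(4)[OF fin, of "n - 2"] n by (simp add: P_def n_def)
  then have s2: "(\<Sum>l\<in>S. l\<^sup>2) \<in> \<rat>" using s1 P[of "n - 2"] by auto
  have c: "c \<in> \<rat>" using s1 by (simp add: c_def)
  have q: "q l \<in> \<rat>" for l unfolding q_def by (intro Rats_divide Rats_of_int Rats_of_nat)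
  \<comment> \<open>\<open>s * d\<^sup>2\<close> is the sum of squared deviations from the mean,
    rational by the power sums above. Two distinct eigenvalues make \<open>s\<close> nonzero, so
    \<open>d\<^sup>2\<close> is rational.\<close>
  define s where "s = (\<Sum>l\<in>S. (q l)\<^sup>2)"
  have "s \<in> \<rat>" using q unfolding s_def by (intro Rats_sum) auto
  have "s \<noteq> 0"
  proof
    assume "s = 0"
    then have "q l1 = 0" "q l2 = 0" using fin l12 by (auto simp: s_def sum_nonneg_eq_0_iff)
    then have "l1 = l2" using ql[OF l12(1)] ql[OF l12(3)] by simp
    then show False using l12 by auto
  qed
  have "s * d\<^sup>2 = (\<Sum>l\<in>S. (q l * d)\<^sup>2)" by (simp add: s_def sum_distrib_right power_mult_distrib)
  also have "\<dots> = (\<Sum>l\<in>S. (l - c)\<^sup>2)"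
  proof (intro sum.cong refl)
    fix l assume "l \<in> S"
    then have "q l * d = l - c" using ql[of l] by linarith
    then show "(q l * d)\<^sup>2 = (l - c)\<^sup>2" by simp
  qed
  also have "\<dots> = (\<Sum>l\<in>S. l\<^sup>2) - 2 * c * \<Sum>S + n * c\<^sup>2"
    by (simp add: power2_diff sum.distrib sum_subtractf sum_distrib_left n_def mult_ac)
  finally have sd2: "s * d\<^sup>2 = (\<Sum>l\<in>S. l\<^sup>2) - 2 * c * \<Sum>S + n * c\<^sup>2" .
  have "s * d\<^sup>2 \<in> \<rat>" unfolding sd2 using s1 s2 c by auto
  then have "s * d\<^sup>2 / s \<in> \<rat>" using \<open>s \<in> \<rat>\<close> by (rule Rats_divide)
  then have d2: "d\<^sup>2 \<in> \<rat>" using \<open>s \<noteq> 0\<close> by simp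
  have "S \<subseteq> \<rat> \<or> (\<exists>c \<delta>. c \<in> \<rat> \<and> \<delta> \<notin> \<rat> \<and> \<delta>\<^sup>2 \<in> \<rat> \<and>
        (\<forall>l\<in>S. \<exists>q\<in>\<rat>. l = c + q * \<delta> \<and> c - q * \<delta> \<in> S \<and> \<epsilon> (c - q * \<delta>) = \<epsilon> l))"
  proof (cases "d \<in> \<rat>")
    case True
    have "l \<in> \<rat>" if "l \<in> S" for l using ql[OF that] True c q[of l] by (metis Rats_add Rats_mult)
    then show ?thesis by blast
  next
    case False
    \<comment> \<open>Both \<open>P\<close> and \<open>G\<close> minus the constant
      \<open>\<epsilon> l\<close> have rational coefficients and vanish at \<open>l\<close>, hence
      also at its conjugate.\<close>
    have "c - q l * d \<in> S \<and> \<epsilon> (c - q l * d) = \<epsilon> l" if l: "l \<in> S" for l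
    proof
      have "poly P (c + q l * d) = 0" using l fin ql[OF l] by (auto simp: P_def poly_prod)
      then have "poly P (c - q l * d) = 0"
        by (rule rational_poly_quadratic_conjugate[OF P c q d2 False])
      then show "c - q l * d \<in> S" using fin by (auto simp: P_def poly_prod)
      have "\<epsilon> l \<in> \<rat>" using pm[OF l] by auto
      then have "coeff (G - [:\<epsilon> l:]) i \<in> \<rat>" for i using G(1) by (cases i) auto
      moreover have "poly (G - [:\<epsilon> l:]) (c + q l * d) = 0" using ql[OF l] by (simp add: \<epsilon>_def)
      ultimately have "poly (G - [:\<epsilon> l:]) (c - q l * d) = 0"
        using rational_poly_quadratic_conjugate[OF _ c q d2 False] by blast
      then show "\<epsilon> (c - q l * d) = \<epsilon> l" by (simp add: \<epsilon>_def)
    qed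
    then show ?thesis using c False d2 q ql by blast
  qed
  then show ?thesis using pm w' e1 e2 by blast
qed

end

section \<open>Laplacians and Q-graphs\<close>

definition lap_matrix :: "'v set \<Rightarrow> ('v \<Rightarrow> 'v \<Rightarrow> bool) \<Rightarrow> 'v \<Rightarrow> 'v \<Rightarrow> int" where
  "lap_matrix V A x y = (if x = y then int (card (nbrs V A x)) else 0) - (if A x y then 1 else 0)"

lemma int_sym_matrix_lap: "simple_graph V A \<Longrightarrow> int_sym_matrix V (lap_matrix V A)"
  by unfold_locales (auto simp: simple_graph_def lap_matrix_def)

lemma laplacian_eq_act:
  assumes "simple_graph V A"
  shows "laplacian V A = int_sym_matrix.act V (lap_matrix V A)"
proof (intro ext)
  fix f :: "'a \<Rightarrow> complex" and x
  interpret int_sym_matrix V "lap_matrix V A" by (rule int_sym_matrix_lap[OF assms])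
  have "(\<Sum>y\<in>V. of_int (lap_matrix V A x y) * f y) =
      (\<Sum>y\<in>V. (if x = y then of_nat (card (nbrs V A x)) * f y else 0) - (if A x y then f y else 0))"
    by (intro sum.cong) (auto simp: lap_matrix_def algebra_simps)
  also have "\<dots> = (\<Sum>y\<in>V. if x = y then of_nat (card (nbrs V A x)) * f y else 0) - (\<Sum>y\<in>nbrs V A x. f y)"
    using finite_X by (simp add: sum_subtractf nbrs_def sum.inter_filter)
  finally show "laplacian V A f x = act f x"
    using finite_X by (simp add: laplacian_def act_def)
qed

lemma exp_lap_decomposition:
  assumes "simple_graph V A" "int_sym_matrix.spectral_decomposition V (lap_matrix V A) S h f"
  shows "exp_lap V A \<tau> f x = (\<Sum>l\<in>S. exp (- \<i> * of_real \<tau> * of_real l) * h l x)"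
proof -
  interpret int_sym_matrix V "lap_matrix V A" by (rule int_sym_matrix_lap[OF assms(1)])
  have "(\<lambda>k. (- \<i> * of_real \<tau> * of_real l) ^ k /\<^sub>R fact k * h l x) sums
      (exp (- \<i> * of_real \<tau> * of_real l) * h l x)" for l :: real
    by (intro sums_mult2 exp_converges)
  then have "(\<lambda>k. \<Sum>l\<in>S. (- \<i> * of_real \<tau> * of_real l) ^ k /\<^sub>R fact k * h l x) sums
      (\<Sum>l\<in>S. exp (- \<i> * of_real \<tau> * of_real l) * h l x)"
    by (intro sums_sum)
  moreover have "(\<Sum>l\<in>S. (- \<i> * of_real \<tau> * of_real l) ^ k /\<^sub>R fact k * h l x) =
      (- \<i> * of_real \<tau>) ^ k / fact k * (laplacian V A ^^ k) f x" for k
    unfolding laplacian_eq_act[OF assms(1)] act_pow_decomposition[OF assms(2)]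
    unfolding power_mult_distrib sum_distrib_left
    by (intro sum.cong) (simp_all add: scaleR_conv_of_real field_simps)
  ultimately show ?thesis unfolding exp_lap_def by (simp add: sums_iff)
qed

lemma pair_state_eqD:
  assumes "\<And>x. x \<in> V \<Longrightarrow> pair_state a b x = pair_state c d x" "a \<in> V" "b \<in> V" "a \<noteq> b" "c \<noteq> d"
  shows "a = c" "b = d"
proof -
  have "pair_state c d a = 1" "pair_state c d b = -1"
    using assms(1)[OF assms(2)] assms(1)[OF assms(3)] assms(4) by (auto simp: pair_state_def char_vec_def)
  then show "a = c" "b = d"
    by (auto simp: pair_state_def char_vec_def split: if_split_asm)
qed

lemma lap_PPST_structure:
  assumes sg: "simple_graph V A" and pst: "lap_PPST V A a b c d"
  shows "\<exists>S h (\<epsilon> :: real \<Rightarrow> real).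
     int_sym_matrix.spectral_decomposition V (lap_matrix V A) S h (pair_state a b) \<and>
     (\<forall>l\<in>S. \<epsilon> l = 1 \<or> \<epsilon> l = -1) \<and> (\<forall>x\<in>V. pair_state c d x = (\<Sum>l\<in>S. of_real (\<epsilon> l) * h l x))
     \<and> (\<exists>l\<in>S. \<epsilon> l = 1) \<and> (\<exists>l\<in>S. \<epsilon> l = -1) \<and>
     (S \<subseteq> \<rat> \<or> (\<exists>c \<delta>. c \<in> \<rat> \<and> \<delta> \<notin> \<rat> \<and> \<delta>\<^sup>2 \<in> \<rat> \<and>
        (\<forall>l\<in>S. \<exists>q\<in>\<rat>. l = c + q * \<delta> \<and> c - q * \<delta> \<in> S \<and> \<epsilon> (c - q * \<delta>) = \<epsilon> l)))"
proof -
  interpret int_sym_matrix V "lap_matrix V A" by (rule int_sym_matrix_lap[OF sg])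
  have V: "a \<in> V" "b \<in> V" "c \<in> V" "d \<in> V" "a \<noteq> b" "c \<noteq> d" "{a, b} \<noteq> {c, d}"
    using pst by (auto simp: lap_PPST_def)
  obtain \<tau> \<chi> where tc: "cmod \<chi> = 1" "\<And>x. x \<in> V \<Longrightarrow> exp_lap V A \<tau> (pair_state a b) x = \<chi> * pair_state c d x"
    using pst by (auto simp: lap_PPST_def)
  have "pair_state a b x = 0" if "x \<notin> V" for x
    using V that by (auto simp: pair_state_def char_vec_def)
  then obtain S h where sd: "spectral_decomposition S h (pair_state a b)"
    using spectral_decomposition_exists by blast
  have rat: "pair_state u v x \<in> of_real ` \<rat>" for u v x :: 'a
  proof -
    have "pair_state u v x = of_real ((if x = u then 1 else 0) - (if x = v then 1 else 0))"
      by (simp add: pair_state_def char_vec_def)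
    then show ?thesis by (rule image_eqI) simp
  qed
  have "\<chi> \<noteq> 0" using tc by auto
  \<comment> \<open>The phase moves to the other side, so its inverse plays the role of
    \<open>\<chi>\<close> in \<open>transfer_structure\<close>.\<close>
  have w: "pair_state c d x = (\<Sum>l\<in>S. inverse \<chi> * exp (- \<i> * of_real \<tau> * of_real l) * h l x)"
    if "x \<in> V" for x
  proof -
    have "pair_state c d x = inverse \<chi> * exp_lap V A \<tau> (pair_state a b) x"
      using tc(2)[OF that] \<open>\<chi> \<noteq> 0\<close> by simp
    then show ?thesis
      by (simp add: exp_lap_decomposition[OF sg sd] sum_distrib_left mult.assoc)
  qed
  \<comment> \<open>Negating a pair state swaps its two vertices, so distinctness of the unordered
    pairs excludes both equality and equality up to sign.\<close>
  have ne1: "\<exists>x\<in>V. pair_state c d x \<noteq> pair_state a b x"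
    using pair_state_eqD[of V a b c d] V by metis
  have "- pair_state a b x = pair_state b a x" for x :: 'a by (simp add: pair_state_def)
  then have ne2: "\<exists>x\<in>V. pair_state c d x \<noteq> - pair_state a b x"
    using pair_state_eqD[of V b a c d] V by (metis insert_commute)
  have \<chi>': "cmod (inverse \<chi>) = 1" using tc by (simp add: norm_inverse)
  from transfer_structure[OF sd rat rat \<chi>' w ne1 ne2] show ?thesis using sd by blast
qed

section \<open>The Q-graph of a regular graph and its Laplacian\<close>

locale regular_graph =
  fixes V :: "'v set" and E :: "'v \<Rightarrow> 'v \<Rightarrow> bool" and r :: nat
  assumes sg: "simple_graph V E" and conn: "connected_graph V E" and reg: "regular V E r"
begin

abbreviation N :: "'v \<Rightarrow> 'v set" where "N \<equiv> nbrs V E"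
abbreviation Q :: "('v + 'v set) set" where "Q \<equiv> Q_vertices V E"
abbreviation LQ :: "('v + 'v set \<Rightarrow> complex) \<Rightarrow> 'v + 'v set \<Rightarrow> complex" where
  "LQ \<equiv> laplacian (Q_vertices V E) (Q_adj V E)"

lemma fin: "finite V" and E_V: "E a b \<Longrightarrow> a \<in> V \<and> b \<in> V" and E_sym: "E a b \<Longrightarrow> E b a" and E_irr: "\<not> E a a"
  using sg by (auto simp: simple_graph_def)

lemma finN: "finite (N a)" and N_iff: "b \<in> N a \<longleftrightarrow> E a b"
  using fin E_V by (auto simp: nbrs_def)

lemma cardN: "a \<in> V \<Longrightarrow> card (N a) = r"
  using reg by (simp add: regular_def)

lemma edges_iff: "e \<in> edges V E \<longleftrightarrow> (\<exists>a b. E a b \<and> e = {a, b})"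
  using E_V by (auto simp: edges_def)

lemma fin_edges: "finite (edges V E)"
  by (rule finite_subset[of _ "Pow V"]) (use E_V fin in \<open>auto simp: edges_iff\<close>)

definition inc :: "'v \<Rightarrow> 'v set set" where "inc a = {e \<in> edges V E. a \<in> e}"

lemma finite_inc: "finite (inc a)" using fin_edges by (simp add: inc_def)

lemma sum_inc: "(\<Sum>e\<in>inc a. g e) = (\<Sum>b\<in>N a. g {a, b})"
proof -
  have "inc a = (\<lambda>b. {a, b}) ` N a"
  proof (intro equalityI subsetI)
    fix e assume "e \<in> inc a"
    then obtain b c where bc: "E b c" "e = {b, c}" "a = b \<or> a = c" by (auto simp: inc_def edges_iff)
    then show "e \<in> (\<lambda>b. {a, b}) ` N a"
      using E_sym[OF bc(1)] by (auto simp: N_iff image_iff insert_commute)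
  qed (use N_iff in \<open>auto simp: inc_def edges_iff\<close>)
  moreover have "inj_on (\<lambda>b. {a, b}) (N a)"
    by (auto simp: inj_on_def doubleton_eq_iff)
  ultimately show ?thesis by (simp add: sum.reindex)
qed

lemma inc_Int: "E a b \<Longrightarrow> inc a \<inter> inc b = {{a, b}}"
proof (intro equalityI subsetI)
  fix e assume e: "e \<in> inc a \<inter> inc b" and ab: "E a b"
  then obtain c d where "e = {c, d}" by (auto simp: inc_def edges_iff)
  moreover have "a \<in> e" "b \<in> e" using e by (auto simp: inc_def)
  moreover have "a \<noteq> b" using ab E_irr by auto
  ultimately show "e \<in> {{a, b}}" by auto
qed (auto simp: inc_def edges_iff)

lemma edge_subset: "e \<in> edges V E \<Longrightarrow> e \<subseteq> V"
  using E_V by (auto simp: edges_iff)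

lemma simple_graph_Q: "simple_graph Q (Q_adj V E)"
  unfolding simple_graph_def
proof (intro conjI allI impI)
  show "finite Q" using fin fin_edges by (simp add: Q_vertices_def)
  show "x \<in> Q" "y \<in> Q" if "Q_adj V E x y" for x y
    using that edge_subset by (auto simp: Q_adj_def Q_vertices_def split: sum.splits)
  show "Q_adj V E y x" if "Q_adj V E x y" for x y
    using that by (auto simp: Q_adj_def split: sum.splits)
  show "\<not> Q_adj V E x x" for x by (auto simp: Q_adj_def split: sum.splits)
qed

lemma nbrs_Q_Inl: "nbrs Q (Q_adj V E) (Inl a) = Inr ` inc a"
proof (intro set_eqI)
  fix z
  show "z \<in> nbrs Q (Q_adj V E) (Inl a) \<longleftrightarrow> z \<in> Inr ` inc a"
    by (cases z) (auto simp: nbrs_def Q_adj_def Q_vertices_def inc_def)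
qed

lemma nbrs_Q_Inr:
  assumes "E a b"
  shows "nbrs Q (Q_adj V E) (Inr {a, b}) = {Inl a, Inl b} \<union> Inr ` ((inc a \<union> inc b) - {{a, b}})"
proof -
  have e: "{a, b} \<in> edges V E" using assms by (auto simp: edges_iff)
  have V: "a \<in> V" "b \<in> V" using assms E_V by auto
  show ?thesis
  proof (intro set_eqI)
    fix z
    show "z \<in> nbrs Q (Q_adj V E) (Inr {a, b}) \<longleftrightarrow> z \<in> {Inl a, Inl b} \<union> Inr ` ((inc a \<union> inc b) - {{a, b}})"
      using e V by (cases z) (auto simp: nbrs_def Q_adj_def Q_vertices_def inc_def)
  qed
qed

text \<open>The edge \<open>{a, b}\<close> lies in both incidence sums although it is not its own
  neighbour, so it is subtracted twice.\<close>

lemma sum_nbrs_Q_Inr: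
  fixes g :: "'v + 'v set \<Rightarrow> complex"
  assumes "E a b"
  shows "(\<Sum>z\<in>nbrs Q (Q_adj V E) (Inr {a, b}). g z) = g (Inl a) + g (Inl b)
     + (\<Sum>e\<in>inc a. g (Inr e)) + (\<Sum>e\<in>inc b. g (Inr e)) - 2 * g (Inr {a, b})"
proof -
  have ab: "a \<noteq> b" using assms E_irr by auto
  have mem: "{a, b} \<in> inc a \<union> inc b" using assms by (auto simp: inc_def edges_iff)
  have "(\<Sum>z\<in>nbrs Q (Q_adj V E) (Inr {a, b}). g z) =
     (\<Sum>z\<in>{Inl a, Inl b}. g z) + (\<Sum>z\<in>Inr ` ((inc a \<union> inc b) - {{a, b}}). g z)"
    unfolding nbrs_Q_Inr[OF assms] using finite_inc by (intro sum.union_disjoint) auto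
  also have "(\<Sum>z\<in>Inr ` ((inc a \<union> inc b) - {{a, b}}). g z) = (\<Sum>e\<in>(inc a \<union> inc b) - {{a, b}}. g (Inr e))"
    by (subst sum.reindex) auto
  also have "\<dots> = (\<Sum>e\<in>inc a \<union> inc b. g (Inr e)) - g (Inr {a, b})"
    using mem finite_inc by (subst sum_diff1) auto
  also have "(\<Sum>e\<in>inc a \<union> inc b. g (Inr e)) = (\<Sum>e\<in>inc a. g (Inr e)) + (\<Sum>e\<in>inc b. g (Inr e)) - g (Inr {a, b})"
    using sum.union_inter[OF finite_inc finite_inc, of "\<lambda>e. g (Inr e)" a b] inc_Int[OF assms]
    by (simp add: algebra_simps)
  finally show ?thesis using ab by simp
qed

lemma card_inc: "a \<in> V \<Longrightarrow> card (inc a) = r"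
  using sum_inc[of "\<lambda>_. 1::nat" a] cardN by simp

lemma LQ_Inl: "a \<in> V \<Longrightarrow> LQ u (Inl a) = of_nat r * u (Inl a) - (\<Sum>b\<in>N a. u (Inr {a, b}))"
proof -
  assume a: "a \<in> V"
  have "card (nbrs Q (Q_adj V E) (Inl a)) = r"
    unfolding nbrs_Q_Inl using card_inc[OF a] by (simp add: card_image)
  moreover have "(\<Sum>z\<in>nbrs Q (Q_adj V E) (Inl a). u z) = (\<Sum>b\<in>N a. u (Inr {a, b}))"
    unfolding nbrs_Q_Inl by (subst sum.reindex) (auto simp: sum_inc)
  ultimately show ?thesis using a by (simp add: laplacian_def Q_vertices_def)
qed

text \<open>The degree is \<open>2 * r\<close>; the extra \<open>2\<close> compensates for
  \<open>{a, b}\<close> occurring in both neighbour sums.\<close>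

lemma LQ_Inr:
  assumes "E a b"
  shows "LQ u (Inr {a, b}) = of_nat (2 * r + 2) * u (Inr {a, b}) - u (Inl a) - u (Inl b)
     - (\<Sum>c\<in>N a. u (Inr {a, c})) - (\<Sum>c\<in>N b. u (Inr {b, c}))"
proof -
  have V: "a \<in> V" "b \<in> V" using assms E_V by auto
  have "of_nat (card (nbrs Q (Q_adj V E) (Inr {a, b}))) = (of_nat (2 * r) :: complex)"
    using sum_nbrs_Q_Inr[OF assms, of "\<lambda>_. 1"] card_inc[OF V(1)] card_inc[OF V(2)] by simp
  moreover have "{a, b} \<in> edges V E" using assms by (auto simp: edges_iff)
  ultimately show ?thesis
    by (simp add: laplacian_def Q_vertices_def sum_nbrs_Q_Inr[OF assms, unfolded Q_vertices_def]
        sum_inc algebra_simps del: of_nat_mult)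
qed

lemma sum_nbrs_swap: "(\<Sum>a\<in>V. \<Sum>b\<in>N a. G a b) = (\<Sum>a\<in>V. \<Sum>b\<in>N a. G b a)"
proof -
  have "(\<Sum>a\<in>V. \<Sum>b\<in>{b\<in>V. E a b}. G a b) = (\<Sum>b\<in>V. \<Sum>a\<in>{a\<in>V. E a b}. G a b)"
    by (rule sum.swap_restrict) (use fin in auto)
  moreover have "{a\<in>V. E a b} = {a\<in>V. E b a}" for b using E_sym by blast
  ultimately show ?thesis by (simp add: nbrs_def)
qed

lemma connected_const:
  assumes "\<And>a b. E a b \<Longrightarrow> g a = g b" "a \<in> V" "b \<in> V"
  shows "g a = g b"
proof -
  have "(\<lambda>u v. u \<in> V \<and> v \<in> V \<and> E u v)\<^sup>*\<^sup>* a b" using conn assms by (auto simp: connected_graph_def)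
  then show ?thesis by (induction rule: rtranclp_induct) (use assms(1) in auto)
qed

lemma card_V: "r + 1 \<le> card V"
proof -
  obtain a where a: "a \<in> V" using conn by (auto simp: connected_graph_def)
  have "card (insert a (N a)) \<le> card V" using a fin by (intro card_mono) (auto simp: nbrs_def)
  then show ?thesis using cardN[OF a] finN[of a] N_iff E_irr by simp
qed

section \<open>Eigenvectors of the Q-graph Laplacian\<close>

definition p :: real where "p = real r + 1"

lemma p_pos: "p > 0" and r_eq: "real r = p - 1" and r_eq_complex: "complex_of_nat r = of_real p - 1"
  by (auto simp: p_def)

text \<open>The parameter is the Laplacian eigenvalue shifted by \<open>p\<close>.\<close>

definition qeig :: "real \<Rightarrow> ('v + 'v set \<Rightarrow> complex) \<Rightarrow> bool" where
  "qeig m u \<longleftrightarrow> (\<forall>z\<in>Q. LQ u z = of_real (m + p) * u z) \<and> (\<exists>z\<in>Q. u z \<noteq> 0)"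

lemma qeig_Inl:
  assumes "qeig m u" "a \<in> V"
  shows "(\<Sum>b\<in>N a. u (Inr {a, b})) = - of_real (m + 1) * u (Inl a)"
proof -
  have "LQ u (Inl a) = of_real (m + p) * u (Inl a)"
    using assms by (auto simp: qeig_def Q_vertices_def)
  then have "(\<Sum>b\<in>N a. u (Inr {a, b})) = of_nat r * u (Inl a) - of_real (m + p) * u (Inl a)"
    unfolding LQ_Inl[OF assms(2)] by (metis add_diff_cancel_left' diff_add_cancel)
  then show ?thesis by (simp add: r_eq_complex algebra_simps)
qed

lemma qeig_Inr:
  assumes "qeig m u" "E a b"
  shows "of_real (p - m) * u (Inr {a, b}) = - of_real m * (u (Inl a) + u (Inl b))"
proof -
  have V: "a \<in> V" "b \<in> V" using assms E_V by auto
  have "{a, b} \<in> edges V E" using assms by (auto simp: edges_iff)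
  then have eq: "LQ u (Inr {a, b}) = of_real (m + p) * u (Inr {a, b})"
    using assms(1) by (auto simp: qeig_def Q_vertices_def)
  have "of_nat (2 * r + 2) = 2 * complex_of_real p" by (simp add: p_def)
  then have "of_real (p - m) * u (Inr {a, b}) = of_nat (2 * r + 2) * u (Inr {a, b}) - of_real (m + p) * u (Inr {a, b})"
    by (simp add: algebra_simps)
  also have "\<dots> = - of_real m * (u (Inl a) + u (Inl b))"
    unfolding eq[symmetric] LQ_Inr[OF assms(2)] qeig_Inl[OF assms(1) V(1)] qeig_Inl[OF assms(1) V(2)]
    by (simp add: algebra_simps)
  finally show ?thesis .
qed

text \<open>Summing \<open>qeig_Inr\<close> over the edges at \<open>a\<close> and inserting
  \<open>qeig_Inl\<close> eliminates the edge values. Division by \<open>m\<close> then turns this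
  into an adjacency eigenvalue equation.\<close>

lemma qeig_adj:
  assumes "qeig m u" "a \<in> V"
  shows "of_real m * (\<Sum>b\<in>N a. u (Inl b)) = of_real (p - m\<^sup>2) * u (Inl a)"
proof -
  have "of_real (p - m) * (\<Sum>b\<in>N a. u (Inr {a, b})) = (\<Sum>b\<in>N a. - of_real m * (u (Inl a) + u (Inl b)))"
    unfolding sum_distrib_left by (intro sum.cong refl qeig_Inr[OF assms(1)]) (simp add: N_iff)
  also have "\<dots> = - of_real m * ((of_real p - 1) * u (Inl a) + (\<Sum>b\<in>N a. u (Inl b)))"
    using cardN[OF assms(2)]
    by (simp only: sum_distrib_left[symmetric] sum.distrib sum_constant r_eq_complex)
  finally have eq: "of_real (p - m) * (- of_real (m + 1) * u (Inl a)) =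
      - of_real m * ((of_real p - 1) * u (Inl a) + (\<Sum>b\<in>N a. u (Inl b)))"
    unfolding qeig_Inl[OF assms] .
  have "of_real m * (\<Sum>b\<in>N a. u (Inl b)) =
      - (- of_real m * ((of_real p - 1) * u (Inl a) + (\<Sum>b\<in>N a. u (Inl b)))) - of_real m * (of_real p - 1) * u (Inl a)"
    by (simp add: algebra_simps)
  also have "\<dots> = of_real (p - m\<^sup>2) * u (Inl a)"
    unfolding eq[symmetric] by (simp add: algebra_simps power2_eq_square)
  finally show ?thesis .
qed

text \<open>By \<open>qeig_Inr\<close> the vertex values determine the edge values when
  \<open>m\<close> differs from \<open>p\<close>.\<close>

lemma qeig_nonzero_Inl:
  assumes "qeig m u" "m \<noteq> p"
  shows "\<exists>a\<in>V. u (Inl a) \<noteq> 0"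
proof (rule ccontr)
  assume "\<not> ?thesis"
  then have x: "\<And>a. a \<in> V \<Longrightarrow> u (Inl a) = 0" by blast
  obtain z where z: "z \<in> Q" "u z \<noteq> 0" using assms by (auto simp: qeig_def)
  then obtain a b where ab: "E a b" "z = Inr {a, b}"
    using x by (auto simp: Q_vertices_def edges_iff)
  then have "of_real (p - m) * u z = 0" using qeig_Inr[OF assms(1) ab(1)] x E_V by simp
  then show False using z assms(2) by simp
qed

lemma qeig_nonzero:
  assumes "qeig m u"
  shows "m \<noteq> 0"
proof
  assume m: "m = 0"
  then obtain a where "a \<in> V" "u (Inl a) \<noteq> 0" using qeig_nonzero_Inl[OF assms] p_pos by auto
  then show False using qeig_adj[OF assms, of a] m p_pos by simp
qed

lemma sum_cnj_V_eq_0D: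
  fixes x :: "'v \<Rightarrow> complex"
  assumes "(\<Sum>a\<in>V. x a * cnj (x a)) = 0" "a \<in> V"
  shows "x a = 0"
  by (rule int_sym_matrix.sum_cnj_eq_0D[OF int_sym_matrix_lap[OF sg] assms])

text \<open>For \<open>m = p\<close> the edge relation makes vertex values alternate in sign.
  Reversing all arcs turns the sum \<open>T\<close> into its negative, while \<open>qeig_Inl\<close>
  evaluates \<open>T\<close> as a nonzero multiple of the squared norm on \<open>V\<close>.\<close>

lemma qeig_max_Inl:
  assumes "qeig p u" "a \<in> V"
  shows "u (Inl a) = 0"
proof -
  define x where "x a = u (Inl a)" for a
  have opp: "x b = - x a" if "E a b" for a b
  proof -
    have "x a + x b = 0" using qeig_Inr[OF assms(1) that] p_pos by (simp add: x_def)
    then show ?thesis by (simp add: eq_neg_iff_add_eq_0 add.commute)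
  qed
  define T where "T = (\<Sum>a\<in>V. \<Sum>b\<in>N a. cnj (x a) * u (Inr {a, b}))"
  have "T = (\<Sum>a\<in>V. \<Sum>b\<in>N a. cnj (x b) * u (Inr {b, a}))" unfolding T_def by (rule sum_nbrs_swap)
  also have "\<dots> = (\<Sum>a\<in>V. \<Sum>b\<in>N a. - (cnj (x a) * u (Inr {a, b})))"
  proof (intro sum.cong refl)
    fix a b assume "b \<in> N a"
    then have "x b = - x a" using opp N_iff by blast
    then show "cnj (x b) * u (Inr {b, a}) = - (cnj (x a) * u (Inr {a, b}))"
      by (simp add: insert_commute)
  qed
  also have "\<dots> = - T" by (simp add: T_def sum_negf)
  finally have "T = 0" by simp
  moreover have "T = (\<Sum>a\<in>V. - of_real (p + 1) * (x a * cnj (x a)))"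
    unfolding T_def
  proof (intro sum.cong refl)
    fix a assume "a \<in> V"
    show "(\<Sum>b\<in>N a. cnj (x a) * u (Inr {a, b})) = - of_real (p + 1) * (x a * cnj (x a))"
      unfolding sum_distrib_left[symmetric] qeig_Inl[OF assms(1) \<open>a \<in> V\<close>] by (simp add: x_def)
  qed
  ultimately have "- of_real (p + 1) * (\<Sum>a\<in>V. x a * cnj (x a)) = 0"
    by (simp only: sum_distrib_left)
  moreover have "- complex_of_real (p + 1) \<noteq> 0"
    using p_pos by (simp only: neg_equal_0_iff_equal of_real_eq_0_iff)
  ultimately have "(\<Sum>a\<in>V. x a * cnj (x a)) = 0" by (simp only: mult_eq_0_iff) blast
  then show ?thesis using sum_cnj_V_eq_0D assms(2) by (auto simp: x_def)
qed

lemma qeig_adj':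
  assumes "qeig m u" "a \<in> V"
  shows "(\<Sum>b\<in>N a. u (Inl b)) = of_real (p / m - m) * u (Inl a)"
proof -
  have m: "m \<noteq> 0" by (rule qeig_nonzero[OF assms(1)])
  have "p - m\<^sup>2 = m * (p / m - m)" using m by (simp add: right_diff_distrib power2_eq_square)
  then have "of_real m * (\<Sum>b\<in>N a. u (Inl b)) = of_real m * (of_real (p / m - m) * u (Inl a))"
    using qeig_adj[OF assms] by (simp only: of_real_mult mult.assoc)
  then show ?thesis using m by (simp only: mult_cancel_left of_real_eq_0_iff) simp
qed

lemma qeig_int_eigen_adj:
  assumes "qeig m u" "m \<noteq> p"
  shows "int_eigen V (\<lambda>a b. if E a b then 1 else 0) (p / m - m) (\<lambda>a. u (Inl a))"
proof -
  have "(\<Sum>b\<in>V. of_int (if E a b then 1 else 0) * u (Inl b)) = of_real (p / m - m) * u (Inl a)"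
    if "a \<in> V" for a
  proof -
    have "(\<Sum>b\<in>V. of_int (if E a b then 1 else 0) * u (Inl b)) = (\<Sum>b\<in>V. if E a b then u (Inl b) else 0)"
      by (intro sum.cong) auto
    also have "\<dots> = (\<Sum>b\<in>N a. u (Inl b))" using fin by (simp add: nbrs_def sum.inter_filter)
    finally show ?thesis unfolding qeig_adj'[OF assms(1) that] .
  qed
  then show ?thesis using fin qeig_nonzero_Inl[OF assms] by (auto simp: int_eigen_def)
qed

lemma qeig_int_eigen_lap:
  assumes "qeig m u"
  shows "int_eigen Q (lap_matrix Q (Q_adj V E)) (m + p) u"
proof -
  interpret L: int_sym_matrix Q "lap_matrix Q (Q_adj V E)"
    by (rule int_sym_matrix_lap[OF simple_graph_Q])
  have "L.act u z = of_real (m + p) * u z" if "z \<in> Q" for z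
    using assms that unfolding qeig_def laplacian_eq_act[OF simple_graph_Q] by blast
  then have "(\<Sum>y\<in>Q. of_int (lap_matrix Q (Q_adj V E) z y) * u y) = of_real (m + p) * u z" if "z \<in> Q" for z
    using that by (simp add: L.act_def)
  then show ?thesis using assms L.finite_X unfolding int_eigen_def qeig_def by blast
qed

text \<open>The adjacency equation is read at a vertex of maximal modulus. For \<open>m = p\<close>
  the restriction to \<open>V\<close> may vanish, but the value is then \<open>- r\<close>
  outright.\<close>

lemma qeig_bound:
  assumes "qeig m u"
  shows "\<bar>p / m - m\<bar> \<le> r"
proof (cases "m = p")
  case True then show ?thesis using p_pos by (simp add: r_eq) (simp add: p_def)
next
  case False
  obtain a0 where a0: "a0 \<in> V" "u (Inl a0) \<noteq> 0" using qeig_nonzero_Inl[OF assms False] by blast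
  define M where "M = Max ((\<lambda>a. cmod (u (Inl a))) ` V)"
  have le: "cmod (u (Inl a)) \<le> M" if "a \<in> V" for a
    unfolding M_def using fin that by (intro Max_ge) auto
  have "M \<in> (\<lambda>a. cmod (u (Inl a))) ` V" unfolding M_def using fin a0 by (intro Max_in) auto
  then obtain a where a: "a \<in> V" "cmod (u (Inl a)) = M" by auto
  have "M > 0" using le[OF a0(1)] a0(2) by (smt (verit) zero_less_norm_iff)
  have "\<bar>p / m - m\<bar> * M = cmod (\<Sum>b\<in>N a. u (Inl b))"
    unfolding qeig_adj'[OF assms a(1)] norm_mult norm_of_real a(2) ..
  also have "\<dots> \<le> (\<Sum>b\<in>N a. M)"
    by (intro order_trans[OF norm_sum] sum_mono le) (auto simp: nbrs_def)
  also have "\<dots> = r * M" using cardN[OF a(1)] by simp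
  finally show ?thesis using \<open>M > 0\<close> by simp
qed

text \<open>The equality case of \<open>qeig_bound\<close>.\<close>

lemma qeig_extremal:
  fixes s :: real
  assumes "qeig m u" "p / m - m = s * r" "s = 1 \<or> s = -1" "E a b"
  shows "u (Inl b) = of_real s * u (Inl a)"
proof -
  define x where "x a = u (Inl a)" for a
  have ss: "complex_of_real s * of_real s = 1" "cnj (of_real s) = complex_of_real s" using assms(3) by auto
  \<comment> \<open>The energy \<open>\<Sum>|F a b|\<^sup>2\<close> over all edges vanishes for the extremal eigenvalue.\<close>
  define F where "F a b = x b - of_real s * x a" for a b
  have Ax: "(\<Sum>b\<in>N a. x b) = of_real s * of_nat r * x a" if "a \<in> V" for a
    using qeig_adj'[OF assms(1) that] unfolding assms(2) by (simp add: x_def)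
  have inner: "(\<Sum>b\<in>N a. F a b * cnj (F a b)) = (\<Sum>b\<in>N a. x b * cnj (x b)) - of_nat r * (x a * cnj (x a))"
    if "a \<in> V" for a
  proof -
    have "F a b * cnj (F a b) = x b * cnj (x b) + x a * cnj (x a) - of_real s * cnj (x a) * x b - of_real s * x a * cnj (x b)" for b
    proof -
      have "F a b * cnj (F a b) = x b * cnj (x b) + (of_real s * of_real s) * (x a * cnj (x a)) - of_real s * cnj (x a) * x b - of_real s * x a * cnj (x b)"
        by (simp add: F_def algebra_simps)
      then show ?thesis by (simp add: ss)
    qed
    then have "(\<Sum>b\<in>N a. F a b * cnj (F a b)) = (\<Sum>b\<in>N a. x b * cnj (x b)) + of_nat r * (x a * cnj (x a))
        - of_real s * cnj (x a) * (\<Sum>b\<in>N a. x b) - of_real s * x a * cnj (\<Sum>b\<in>N a. x b)"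
      using cardN[OF that] by (simp add: sum.distrib sum_subtractf sum_distrib_left)
    also have "of_real s * cnj (x a) * (\<Sum>b\<in>N a. x b) = (of_real s * of_real s) * (of_nat r * (x a * cnj (x a)))"
      unfolding Ax[OF that] by (simp add: mult_ac)
    also have "of_real s * x a * cnj (\<Sum>b\<in>N a. x b) = (of_real s * of_real s) * (of_nat r * (x a * cnj (x a)))"
      unfolding Ax[OF that] by (simp add: mult_ac)
    finally show ?thesis by (simp add: ss)
  qed
  have "(\<Sum>a\<in>V. \<Sum>b\<in>N a. F a b * cnj (F a b)) =
     (\<Sum>a\<in>V. \<Sum>b\<in>N a. x b * cnj (x b)) - (\<Sum>a\<in>V. of_nat r * (x a * cnj (x a)))"
    by (simp add: inner sum_subtractf)
  also have "(\<Sum>a\<in>V. \<Sum>b\<in>N a. x b * cnj (x b)) = (\<Sum>a\<in>V. \<Sum>b\<in>N a. x a * cnj (x a))"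
    by (rule sum_nbrs_swap)
  also have "\<dots> = (\<Sum>a\<in>V. of_nat r * (x a * cnj (x a)))" by (simp add: cardN)
  finally have "complex_of_real (\<Sum>a\<in>V. \<Sum>b\<in>N a. (cmod (F a b))\<^sup>2) = 0"
    by (simp add: complex_norm_square del: of_real_power)
  then have "(\<Sum>a\<in>V. \<Sum>b\<in>N a. (cmod (F a b))\<^sup>2) = 0" by (simp only: of_real_eq_0_iff)
  then have "\<forall>a\<in>V. \<forall>b\<in>N a. (cmod (F a b))\<^sup>2 = 0"
    using fin finN by (simp add: sum_nonneg_eq_0_iff sum_nonneg)
  then have "F a b = 0" using assms(4) E_V N_iff by auto
  then show ?thesis by (simp add: F_def x_def)
qed

text \<open>The shift \<open>- p\<close> is Laplacian eigenvalue zero and adjacency eigenvalue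
  \<open>r\<close>; connectedness makes the vertex values constant, and \<open>qeig_Inr\<close>
  extends this to the edges.\<close>

lemma qeig_zero_const:
  assumes "qeig (- p) u"
  shows "\<exists>k. \<forall>z\<in>Q. u z = k"
proof -
  have "p / (- p) - (- p) = 1 * r" using p_pos by (simp add: r_eq)
  then have eq: "u (Inl a) = u (Inl b)" if "E a b" for a b
    using qeig_extremal[OF assms, of 1 a b] that by simp
  obtain a where a: "a \<in> V" using conn by (auto simp: connected_graph_def)
  have x: "u (Inl b) = u (Inl a)" if "b \<in> V" for b
    using connected_const[of "\<lambda>b. u (Inl b)", OF eq that a] by simp
  have y: "u (Inr {b, c}) = u (Inl a)" if "E b c" for b c
  proof -
    have "of_real (2 * p) * u (Inr {b, c}) = of_real (2 * p) * u (Inl a)"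
      using qeig_Inr[OF assms that] x E_V[OF that] by (simp add: algebra_simps)
    then show ?thesis using p_pos by (simp only: mult_cancel_left of_real_eq_0_iff) simp
  qed
  show ?thesis using x y by (intro exI[of _ "u (Inl a)"]) (auto simp: Q_vertices_def edges_iff)
qed

end

section \<open>Eigenvalues when the degree plus one is prime\<close>

lemma rat_square_int_imp_int:
  fixes k :: real
  assumes "k \<in> \<rat>" "k\<^sup>2 \<in> \<int>"
  shows "k \<in> \<int>"
proof -
  obtain d :: int where d: "d > 0" "of_int d * k \<in> \<int>"
    using common_denominator[of "{k}" "\<lambda>x. x"] assms(1) by auto
  \<comment> \<open>Induction in steps of two: since \<open>k\<^sup>2\<close> is an integer, a
    denominator for \<open>k\<close> serves every power.\<close>
  have "of_int d * k ^ j \<in> \<int>" for j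
  proof (induction j rule: less_induct)
    case (less j)
    consider "j = 0" | "j = 1" | i where "j = i + 2"
      by (metis One_nat_def Suc_eq_plus1 add_2_eq_Suc' not0_implies_Suc)
    then show ?case
    proof cases
      case (3 i)
      have "of_int d * k ^ i \<in> \<int>" using less[of i] 3 by simp
      then have "(of_int d * k ^ i) * k\<^sup>2 \<in> \<int>" using assms(2) by (rule Ints_mult)
      then show ?thesis using 3 by (simp add: power2_eq_square mult_ac)
    qed (use d in auto)
  qed
  then show ?thesis using bounded_denominator_powers_imp_int assms(1) d(1) by blast
qed

text \<open>A square would factor \<open>16 * P\<^sup>2\<close> into positive even \<open>a\<close>
  and \<open>b\<close> with sum \<open>2 * t\<^sup>2\<close>. Smallness of \<open>t\<close> forces
  \<open>P\<close> to divide both, hence \<open>t\<close>, which is impossible for nonzero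
  \<open>t\<close> below \<open>P\<close>.\<close>

lemma prime_fourth_power_not_square:
  fixes t k P :: int
  assumes "prime P" "odd P" "\<bar>t\<bar> < P"
  shows "k\<^sup>2 \<noteq> t ^ 4 - 16 * P\<^sup>2"
proof
  assume eq: "k\<^sup>2 = t ^ 4 - 16 * P\<^sup>2"
  have Ppos: "P > 1" using assms(1) by (simp add: prime_gt_1_int)
  define a b where "a = t\<^sup>2 - \<bar>k\<bar>" and "b = t\<^sup>2 + \<bar>k\<bar>"
  have "a * b = (t\<^sup>2)\<^sup>2 - \<bar>k\<bar>\<^sup>2" by (simp add: a_def b_def algebra_simps power2_eq_square)
  also have "\<dots> = 16 * P\<^sup>2" using eq by (simp add: power_mult[symmetric])
  finally have ab: "a * b = 16 * P\<^sup>2" .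
  have "a * b > 0" using ab Ppos by simp
  moreover have "b \<ge> 0" by (simp add: b_def)
  ultimately have pos: "a > 0" "b > 0" by (auto simp: zero_less_mult_iff)
  have s: "a + b = 2 * t\<^sup>2" by (simp add: a_def b_def)
  have t0: "t \<noteq> 0" using s pos by auto
  have tP: "t\<^sup>2 < P\<^sup>2" using assms(3) by (metis abs_le_square_iff abs_of_pos linorder_not_le Ppos zero_less_one less_trans)
  have ev: "even a" "even b"
  proof -
    have "even (a * b)" "even (a + b)" unfolding ab s by auto
    then show "even a" "even b" by auto
  qed
  \<comment> \<open>If \<open>P\<close> misses one factor, the other is an even multiple of
    \<open>P\<^sup>2\<close> and already exceeds the sum \<open>2 * t\<^sup>2\<close>.\<close>
  have big: False if nd: "\<not> P dvd x" and xy: "x * y = 16 * P\<^sup>2" "x + y = 2 * t\<^sup>2" "x > 0" "y > 0" "even y" for x y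
  proof -
    have "coprime (P\<^sup>2) x" using nd assms(1) by (simp add: prime_imp_coprime)
    moreover have "P\<^sup>2 dvd x * y" unfolding xy by simp
    ultimately have "P\<^sup>2 dvd y" by (simp add: coprime_dvd_mult_right_iff)
    moreover have "coprime 2 (P\<^sup>2)" using assms(2) by simp
    ultimately have "2 * P\<^sup>2 dvd y" using xy(5) by (intro divides_mult) auto
    then have "2 * P\<^sup>2 \<le> y" using xy(4) by (rule zdvd_imp_le)
    then show False using xy tP by linarith
  qed
  have "P dvd a" using big[of a b] ab s pos ev by blast
  moreover have "P dvd b" using big[of b a] ab s pos ev by (auto simp: mult.commute add.commute)
  ultimately have "P dvd 2 * t\<^sup>2" unfolding s[symmetric] by (rule dvd_add)
  moreover have "\<not> P dvd 2"
  proof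
    assume "P dvd 2"
    then have "P \<le> 2" by (rule zdvd_imp_le) simp
    then have "P = 2" using Ppos by simp
    then show False using assms(2) by simp
  qed
  ultimately have "P dvd t" using assms(1) by (simp add: prime_dvd_mult_iff prime_dvd_power_iff)
  then show False using t0 assms(3) by (metis abs_dvd_iff abs_of_pos dvd_abs_iff linorder_not_less zdvd_imp_le zero_less_abs_iff)
qed

lemma prime_square_divisor:
  fixes n k :: real and P :: nat
  assumes "prime P" "n \<in> \<int>" "k \<in> \<int>" "n * k = (real P)\<^sup>2"
  shows "\<bar>n\<bar> = 1 \<or> \<bar>n\<bar> = P \<or> \<bar>n\<bar> = (real P)\<^sup>2"
proof -
  obtain N K :: int where NK: "n = of_int N" "k = of_int K" using assms(2,3) by (auto elim!: Ints_cases)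
  have "real_of_int (N * K) = real_of_int ((int P)\<^sup>2)" using assms(4) NK by simp
  then have "N * K = (int P)\<^sup>2" by (simp only: of_int_eq_iff)
  then have "N dvd (int P)\<^sup>2" by (metis dvd_triv_left)
  then have "nat \<bar>N\<bar> dvd P\<^sup>2" by (metis nat_abs_dvd_iff of_nat_power int_dvd_int_iff abs_dvd_iff int_nat_eq abs_ge_zero nat_0_le)
  then obtain i where i: "i \<le> 2" "nat \<bar>N\<bar> = P ^ i" using divides_primepow_nat[OF assms(1)] by blast
  have "\<bar>n\<bar> = real (nat \<bar>N\<bar>)" by (simp add: NK)
  then have "\<bar>n\<bar> = real P ^ i" using i by simp
  moreover have "i = 0 \<or> i = 1 \<or> i = 2" using i(1) by linarith
  ultimately show ?thesis by auto
qed

lemma abs_bounds_of_diff_quotient: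
  fixes m p :: real
  assumes "m \<noteq> 0" "p > 0" "\<bar>p / m - m\<bar> \<le> p - 1"
  shows "1 \<le> \<bar>m\<bar>" "\<bar>m\<bar> \<le> p"
proof -
  define x where "x = \<bar>m\<bar>"
  have x: "x > 0" using assms by (simp add: x_def)
  have "\<bar>p / x - x\<bar> = \<bar>p / m - m\<bar>" by (auto simp: x_def abs_if)
  then have "\<bar>p / x - x\<bar> \<le> p - 1" using assms by simp
  then have "p / x - x \<le> p - 1" "x - p / x \<le> p - 1" by linarith+
  then have "p \<le> (p - 1) * x + x * x" "x * x \<le> (p - 1) * x + p" using x by (auto simp: field_simps)
  \<comment> \<open>Both quadratic inequalities factor, with roots \<open>1\<close>,
    \<open>- p\<close> and \<open>p\<close>, \<open>-1\<close>.\<close>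
  then have "(x - 1) * (x + p) \<ge> 0" "(p - x) * (x + 1) \<ge> 0" by (auto simp: algebra_simps)
  then show "1 \<le> \<bar>m\<bar>" "\<bar>m\<bar> \<le> p" using x assms(2) by (auto simp: x_def[symmetric] zero_le_mult_iff)
qed

locale prime_regular_graph = regular_graph V E r
  for V :: "'v set" and E :: "'v \<Rightarrow> 'v \<Rightarrow> bool" and r :: nat +
  assumes pr: "prime (r + 1)" and r2: "r \<ge> 2"
begin

lemma p_nat: "p = real (r + 1)" by (simp add: p_def)

lemma p_ge_3: "p \<ge> 3" using r2 by (simp add: p_def)

lemma p_Ints: "p \<in> \<int>" unfolding p_nat by (rule Ints_of_nat)

lemma qeig_abs: "qeig m u \<Longrightarrow> 1 \<le> \<bar>m\<bar>" "qeig m u \<Longrightarrow> \<bar>m\<bar> \<le> p"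
  using abs_bounds_of_diff_quotient[of m p] qeig_nonzero qeig_bound p_pos unfolding r_eq by blast+

text \<open>Being rational algebraic integers, \<open>m + p\<close> and \<open>p / m - m\<close> are
  integers, so \<open>m\<close> divides the prime \<open>p\<close>.\<close>

lemma qeig_rational:
  assumes "qeig m u" "m \<in> \<rat>"
  shows "m = 1 \<or> m = -1 \<or> m = p \<or> m = -p"
proof (cases "m = p")
  case False
  have pr': "p \<in> \<rat>" by (simp add: p_def)
  have "m + p \<in> \<int>" using int_eigen_rat_imp_int[OF qeig_int_eigen_lap[OF assms(1)]] assms(2) pr' by auto
  then have mi: "m \<in> \<int>" using p_Ints by (metis Ints_diff add_diff_cancel_right')
  have "p / m - m \<in> \<int>"
    using int_eigen_rat_imp_int[OF qeig_int_eigen_adj[OF assms(1) False]] assms(2) pr' by auto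
  then have "p / m \<in> \<int>" using mi by (metis Ints_add diff_add_cancel)
  then obtain k where k: "p / m = of_int k" by (auto elim: Ints_cases)
  obtain j where j: "m = of_int j" using mi by (auto elim: Ints_cases)
  have "m * of_int k = p" using k qeig_nonzero[OF assms(1)] by (simp add: field_simps)
  then have "real_of_int (j * k) = real_of_int (int (r + 1))" using j by (simp add: p_nat)
  then have "j * k = int (r + 1)" by (simp only: of_int_eq_iff)
  then have "j dvd int (r + 1)" by (metis dvd_triv_left)
  then have "nat \<bar>j\<bar> dvd r + 1" by (simp add: nat_abs_dvd_iff)
  then have "nat \<bar>j\<bar> = 1 \<or> nat \<bar>j\<bar> = r + 1" using pr by (simp add: prime_nat_iff)
  then have "\<bar>m\<bar> = 1 \<or> \<bar>m\<bar> = p" unfolding j p_nat by auto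
  then show ?thesis by auto
qed simp

text \<open>Kronecker certificates for the Laplacian make trace \<open>t\<close> and norm
  \<open>n\<close> integers, and those for the adjacency matrix make \<open>p\<^sup>2 / n\<close>
  one. Of the divisors of \<open>p\<^sup>2\<close>, the strict bounds on the irrational
  \<open>m\<close> leave only \<open>p\<close> in absolute value.\<close>

lemma qeig_conjugate_pair:
  assumes q: "qeig m u" "qeig m' u'" and irr: "m \<notin> \<rat>" "m' \<notin> \<rat>" and rat: "m + m' \<in> \<rat>" "m * m' \<in> \<rat>"
  shows "m + m' \<in> \<int> \<and> (m * m' = p \<and> \<bar>m + m'\<bar> \<le> p + 1 \<or> m * m' = - p \<and> \<bar>m + m'\<bar> \<le> p - 1)"
proof -
  have pr': "p \<in> \<rat>" by (simp add: p_def)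
  have ne: "m \<noteq> p" "m' \<noteq> p" using irr pr' by auto
  have m0: "m \<noteq> 0" "m' \<noteq> 0" using qeig_nonzero q by blast+
  define t n where "t = m + m'" and "n = m * m'"
  have n0: "n \<noteq> 0" using m0 by (simp add: n_def)
  have "(m + p) + (m' + p) \<in> \<int>"
  proof (rule int_eigen_rat_imp_int[OF int_eigen_add[OF qeig_int_eigen_lap[OF q(1)] qeig_int_eigen_lap[OF q(2)]]])
    have "(m + p) + (m' + p) = (m + m') + 2 * p" by simp
    also have "\<dots> \<in> \<rat>" using rat pr' by auto
    finally show "(m + p) + (m' + p) \<in> \<rat>" .
  qed
  then have "(m + p) + (m' + p) - 2 * p \<in> \<int>" using p_Ints by auto
  then have ti: "t \<in> \<int>" by (simp add: t_def)
  have "(m + p) * (m' + p) \<in> \<int>"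
  proof (rule int_eigen_rat_imp_int[OF int_eigen_mult[OF qeig_int_eigen_lap[OF q(1)] qeig_int_eigen_lap[OF q(2)]]])
    have "(m + p) * (m' + p) = m * m' + p * (m + m') + p * p" by (simp add: algebra_simps)
    also have "\<dots> \<in> \<rat>" using rat pr' by auto
    finally show "(m + p) * (m' + p) \<in> \<rat>" .
  qed
  then have "(m + p) * (m' + p) - p * t - p * p \<in> \<int>" using p_Ints ti by auto
  then have ni: "n \<in> \<int>" by (simp add: n_def t_def algebra_simps)
  note adj = qeig_int_eigen_adj[OF q(1) ne(1)] qeig_int_eigen_adj[OF q(2) ne(2)]
  have a1: "(p / m - m) + (p / m' - m') = p * t / n - t"
    using m0 by (simp add: t_def n_def field_simps)
  have a2: "(p / m - m) * (p / m' - m') = p\<^sup>2 / n + n - t * (p * t / n) + 2 * p"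
    using m0 by (simp add: t_def n_def field_simps power2_eq_square)
  have tn: "t \<in> \<rat>" "n \<in> \<rat>" using rat by (auto simp: t_def n_def)
  have "p * t / n - t \<in> \<int>" unfolding a1[symmetric]
    by (rule int_eigen_rat_imp_int[OF int_eigen_add[OF adj]], unfold a1) (use tn pr' in auto)
  then have i1: "p * t / n \<in> \<int>" using ti by (metis Ints_add diff_add_cancel)
  define A where "A = p\<^sup>2 / n + n - t * (p * t / n) + 2 * p"
  have "A \<in> \<int>" unfolding A_def a2[symmetric]
    by (rule int_eigen_rat_imp_int[OF int_eigen_mult[OF adj]], unfold a2) (use tn pr' in auto)
  then have "A - n + t * (p * t / n) - 2 * p \<in> \<int>"
    using ti ni i1 p_Ints by (intro Ints_add Ints_diff Ints_mult) auto
  then have i2: "p\<^sup>2 / n \<in> \<int>" by (simp add: A_def)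
  have "n * (p\<^sup>2 / n) = (real (r + 1))\<^sup>2" using n0 by (simp add: p_nat)
  from prime_square_divisor[OF pr ni i2 this]
  have cases: "\<bar>n\<bar> = 1 \<or> \<bar>n\<bar> = p \<or> \<bar>n\<bar> = p\<^sup>2" by (simp add: p_nat)
  have b: "1 \<le> \<bar>m\<bar>" "\<bar>m\<bar> \<le> p" "1 \<le> \<bar>m'\<bar>" "\<bar>m'\<bar> \<le> p" using qeig_abs q by blast+
  have absn: "\<bar>n\<bar> = \<bar>m\<bar> * \<bar>m'\<bar>" by (simp add: n_def abs_mult)
  have "m \<noteq> 1" "m \<noteq> -1" "m \<noteq> p" "m \<noteq> - p" using irr(1) pr' by auto
  then have mne: "\<bar>m\<bar> \<noteq> 1" "\<bar>m\<bar> \<noteq> p" by linarith+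
  have "\<bar>n\<bar> \<noteq> 1"
  proof
    assume "\<bar>n\<bar> = 1"
    moreover have "\<bar>m\<bar> * 1 \<le> \<bar>m\<bar> * \<bar>m'\<bar>" using b by (intro mult_left_mono) auto
    ultimately show False using absn b mne by simp
  qed
  moreover have "\<bar>n\<bar> \<noteq> p\<^sup>2"
  proof
    assume "\<bar>n\<bar> = p\<^sup>2"
    moreover have "\<bar>m\<bar> * \<bar>m'\<bar> \<le> \<bar>m\<bar> * p" using b by (intro mult_left_mono) auto
    ultimately have "p * p \<le> \<bar>m\<bar> * p" using absn by (simp add: power2_eq_square)
    then have "p \<le> \<bar>m\<bar>" using p_pos by simp
    then show False using b mne by simp
  qed
  ultimately have np: "\<bar>n\<bar> = p" using cases by blast
  show ?thesis
  proof (cases "n = p")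
    case True
    have "0 \<le> (\<bar>m\<bar> - 1) * (\<bar>m'\<bar> - 1)" using b by simp
    also have "\<dots> = p - \<bar>m\<bar> - \<bar>m'\<bar> + 1" using absn np by (simp add: algebra_simps)
    finally show ?thesis using True ti by (auto simp: n_def t_def)
  next
    case False
    then have n': "n = - p" using np by linarith
    then have "m' = - p / m" using m0 by (simp add: n_def field_simps)
    then have "m + m' = - (p / m - m)" by simp
    then have "\<bar>m + m'\<bar> \<le> p - 1" using qeig_bound[OF q(1)] unfolding r_eq by simp
    then show ?thesis using n' ti by (auto simp: n_def t_def)
  qed
qed

text \<open>The discriminants of the two quadratics are \<open>c\<^sup>2 - p\<close> and
  \<open>c\<^sup>2 + p\<close> up to a factor. Both roots lying in one quadratic field makes the
  product of discriminants a rational square.\<close>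

lemma conjugate_types_exclusive:
  assumes t: "2 * c \<in> \<int>" "\<bar>2 * c\<bar> \<le> p - 1"
    and m1: "m1 * (2 * c - m1) = p" and m2: "m2 * (2 * c - m2) = - p"
    and rat: "(m1 - c) * (m2 - c) \<in> \<rat>"
  shows False
proof -
  \<comment> \<open>The factor \<open>4\<close> clears the denominator of \<open>c\<close>, half an
    integer, so that \<open>k\<^sup>2\<close> is an integer.\<close>
  define k where "k = 4 * ((m1 - c) * (m2 - c))"
  have "(m1 - c)\<^sup>2 = c\<^sup>2 - p" "(m2 - c)\<^sup>2 = c\<^sup>2 + p"
    using m1 m2 by (auto simp: algebra_simps power2_eq_square)
  then have k2: "k\<^sup>2 = 16 * ((c\<^sup>2 - p) * (c\<^sup>2 + p))" by (simp add: k_def power_mult_distrib)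
  obtain T where T: "2 * c = of_int T" using t(1) by (auto elim: Ints_cases)
  define P where "P = int (r + 1)"
  have P: "p = of_int P" by (simp add: P_def p_nat)
  have c: "c = of_int T / 2" using T by simp
  have k2': "k\<^sup>2 = of_int (T ^ 4 - 16 * P\<^sup>2)"
    unfolding k2 P c by (simp add: field_simps power2_eq_square power4_eq_xxxx)
  have "k \<in> \<rat>" using rat by (simp add: k_def)
  then have "k \<in> \<int>" by (rule rat_square_int_imp_int) (simp only: k2' Ints_of_int)
  then obtain K where K: "k = of_int K" by (auto elim: Ints_cases)
  have "real_of_int (K\<^sup>2) = of_int (T ^ 4 - 16 * P\<^sup>2)" using k2' K by simp
  then have KT: "K\<^sup>2 = T ^ 4 - 16 * P\<^sup>2" by (simp only: of_int_eq_iff)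
  have "odd (r + 1)" using pr r2 by (intro prime_odd_nat) auto
  then have "odd P" unfolding P_def by simp
  moreover have "prime P" unfolding P_def prime_nat_int_transfer by (rule pr)
  moreover have "\<bar>T\<bar> < P" using t(2) unfolding T P by linarith
  ultimately show False using prime_fourth_power_not_square KT by blast
qed

section \<open>Excluding transfer with rational or irrational support\<close>

lemma exists_nbr: "a \<in> V \<Longrightarrow> \<exists>b. E a b"
  using cardN[of a] r2 N_iff by (metis all_not_in_conv card.empty not_numeral_le_zero)

lemma exists_second_nbr:
  assumes "E a b"
  shows "\<exists>c. E b c \<and> c \<noteq> a"
proof -
  have "card (N b - {a}) \<ge> 1"
    using cardN[of b] r2 E_V[OF assms] finN[of b] by (auto simp: card_Diff_singleton_if)
  then obtain c where "c \<in> N b - {a}" by (metis all_not_in_conv card.empty not_one_le_zero)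
  then show ?thesis using N_iff by auto
qed

lemma qeig_one_edge: "qeig 1 u \<Longrightarrow> E a b \<Longrightarrow> u (Inl b) = u (Inl a)"
  using qeig_extremal[of 1 u 1 a b] by (simp add: r_eq)

lemma qeig_minus_one_edge: "qeig (-1) u \<Longrightarrow> E a b \<Longrightarrow> u (Inl b) = - u (Inl a)"
  using qeig_extremal[of "-1" u "-1" a b] by (simp add: r_eq)

lemma pair_state_inj: "pair_state a b x = pair_state a b y \<Longrightarrow> pair_state a b x \<noteq> 0 \<Longrightarrow> x = y"
  by (auto simp: pair_state_def char_vec_def split: if_split_asm)

lemma no_rational_transfer:
  assumes fin: "finite S" and qe: "\<And>l. l \<in> S \<Longrightarrow> qeig (l - p) (h l)"
    and v: "\<And>x. pair_state a b x = (\<Sum>l\<in>S. h l x)"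
    and rat: "\<And>l. l \<in> S \<Longrightarrow> l - p = 1 \<or> l - p = -1 \<or> l - p = p"
    and l12: "l1 \<in> S" "l2 \<in> S" "l1 \<noteq> l2"
  shows False
proof -
  have edge1: "h l (Inl y) = h l (Inl x)" if "l \<in> S" "l - p = 1" "E x y" for l x y
    using qe[OF that(1)] that qeig_one_edge by simp
  have edge2: "h l (Inl y) = - h l (Inl x)" if "l \<in> S" "l - p = -1" "E x y" for l x y
    using qe[OF that(1)] that qeig_minus_one_edge by simp
  have edge3: "h l (Inl x) = 0" if "l \<in> S" "l - p = p" "x \<in> V" for l x
    using qe[OF that(1)] that qeig_max_Inl by simp
  \<comment> \<open>Along a walk of length two the signs from \<open>m = -1\<close> cancel, so all
    components agree at its ends, whereas a nonzero value of a pair state occurs only once.\<close>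
  have f0: "pair_state a b (Inl x) = 0" if x: "x \<in> V" for x
  proof (rule ccontr)
    assume nz: "pair_state a b (Inl x) \<noteq> 0"
    obtain y where y: "E x y" using exists_nbr[OF x] by blast
    obtain z where z: "E y z" "z \<noteq> x" using exists_second_nbr[OF y] by blast
    have "h l (Inl z) = h l (Inl x)" if "l \<in> S" for l
      using rat[OF that] edge1[OF that _ y] edge1[OF that _ z(1)] edge2[OF that _ y] edge2[OF that _ z(1)]
        edge3[OF that] x E_V[OF z(1)] by auto
    then have "pair_state a b (Inl z) = pair_state a b (Inl x)" unfolding v by (intro sum.cong) auto
    then show False using pair_state_inj[of a b "Inl z" "Inl x"] nz z(2) by auto
  qed
  have "l - p = p" if l: "l \<in> S" for l
  proof (rule ccontr)
    assume "l - p \<noteq> p"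
    then obtain x where x: "x \<in> V" "h l (Inl x) \<noteq> 0" using qeig_nonzero_Inl[OF qe[OF l]] by blast
    obtain y where y: "E x y" using exists_nbr[OF x(1)] by blast
    have V: "y \<in> V" using E_V[OF y] by blast
    \<comment> \<open>Adding \<open>s\<close> times the value at a neighbour doubles the component
      of \<open>l\<close> and cancels the one with opposite edge sign.\<close>
    define s :: complex where "s = (if l - p = 1 then 1 else -1)"
    have summand: "h k (Inl x) + s * h k (Inl y) = (if k = l then 2 * h l (Inl x) else 0)" if k: "k \<in> S" for k
    proof (cases "k = l")
      case True
      then show ?thesis using rat[OF l] \<open>l - p \<noteq> p\<close> edge1[OF l _ y] edge2[OF l _ y] by (auto simp: s_def)
    next
      case False
      then show ?thesis using rat[OF l] rat[OF k] \<open>l - p \<noteq> p\<close> edge1[OF k _ y] edge2[OF k _ y]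
         edge3[OF k _ x(1)] edge3[OF k _ V] by (auto simp: s_def)
    qed
    have "0 = pair_state a b (Inl x) + s * pair_state a b (Inl y)" using f0[OF x(1)] f0[OF V] by simp
    also have "\<dots> = (\<Sum>k\<in>S. h k (Inl x) + s * h k (Inl y))"
      unfolding v by (simp add: sum.distrib sum_distrib_left)
    also have "\<dots> = (\<Sum>k\<in>S. if k = l then 2 * h l (Inl x) else 0)" by (intro sum.cong refl summand)
    also have "\<dots> = 2 * h l (Inl x)" using fin l by simp
    finally show False using x(2) by simp
  qed
  from this[OF l12(1)] this[OF l12(2)] show False using l12(3) by simp
qed

text \<open>Values at adjacent vertices agree up to sign, so one zero would spread over the
  connected graph.\<close>

lemma qeig_pm_one_all_nonzero:
  assumes "qeig m u" "m = 1 \<or> m = -1" "a \<in> V"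
  shows "u (Inl a) \<noteq> 0"
proof
  assume z: "u (Inl a) = 0"
  have "(u (Inl x) = 0) = (u (Inl y) = 0)" if "E x y" for x y
    using assms(1,2) qeig_one_edge[of u x y] qeig_minus_one_edge[of u x y] that by auto
  from connected_const[of "\<lambda>x. u (Inl x) = 0", OF this assms(3)] z
  have "\<forall>x\<in>V. u (Inl x) = 0" by blast
  moreover have "m \<noteq> p" using assms(2) p_ge_3 by auto
  ultimately show False using qeig_nonzero_Inl[OF assms(1)] by blast
qed

lemma no_irrational_transfer:
  assumes fin: "finite S" and qe: "\<And>l. l \<in> S \<Longrightarrow> qeig (l - p) (h l)"
    and v: "\<And>x. pair_state a b x = (\<Sum>l\<in>S. h l x)"
    and w: "\<And>x. x \<in> Q \<Longrightarrow> pair_state a' b' x = (\<Sum>l\<in>S. of_real (\<epsilon> l) * h l x)"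
    and eps: "\<And>l. l \<in> S \<Longrightarrow> \<epsilon> l = 1 \<or> \<epsilon> l = (-1::real)"
    and l12: "l1 \<in> S" "\<epsilon> l1 = 1" "l2 \<in> S" "\<epsilon> l2 = -1"
    and cd: "c \<in> \<rat>" "\<delta> \<notin> \<rat>" "\<delta>\<^sup>2 \<in> \<rat>"
    and conj: "\<And>l. l \<in> S \<Longrightarrow> \<exists>q\<in>\<rat>. l = c + q * \<delta> \<and> c - q * \<delta> \<in> S \<and> \<epsilon> (c - q * \<delta>) = \<epsilon> l"
  shows False
proof -
  define c0 where "c0 = c - p"
  have p_rat: "p \<in> \<rat>" by (simp add: p_def)
  have c0: "c0 \<in> \<rat>" using cd p_rat by (simp add: c0_def)
  have p3: "p \<ge> 3" by (rule p_ge_3)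
  obtain q where q: "\<And>l. l \<in> S \<Longrightarrow> q l \<in> \<rat>" "\<And>l. l \<in> S \<Longrightarrow> l = c + q l * \<delta>"
    "\<And>l. l \<in> S \<Longrightarrow> c - q l * \<delta> \<in> S" "\<And>l. l \<in> S \<Longrightarrow> \<epsilon> (c - q l * \<delta>) = \<epsilon> l" using conj by metis
  have cj: "2 * c - l \<in> S" "\<epsilon> (2 * c - l) = \<epsilon> l" if "l \<in> S" for l
  proof -
    have "c - q l * \<delta> = 2 * c - l" using q(2)[OF that] by linarith
    from q(3,4)[OF that, unfolded this] show "2 * c - l \<in> S" "\<epsilon> (2 * c - l) = \<epsilon> l" .
  qed
  have lc: "l - c = q l * \<delta>" if "l \<in> S" for l using q(2)[OF that] by linarith
  have prodrat: "(l - c) * (k - c) \<in> \<rat>" if "l \<in> S" "k \<in> S" for l k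
  proof -
    have "(l - c) * (k - c) = q l * q k * \<delta>\<^sup>2" unfolding lc[OF that(1)] lc[OF that(2)] by (simp add: power2_eq_square)
    then show ?thesis using q(1) that cd(3) by auto
  qed
  have irr: "l \<notin> \<rat>" if "l \<in> S" "l \<noteq> c" for l
  proof
    assume "l \<in> \<rat>"
    then have "q l * \<delta> \<in> \<rat>" using cd(1) lc[OF that(1)] by (metis Rats_diff)
    moreover have "q l \<noteq> 0" using lc[OF that(1)] that(2) by auto
    ultimately have "q l * \<delta> / q l \<in> \<rat>" using q(1)[OF that(1)] by (intro Rats_divide)
    then show False using cd(2) \<open>q l \<noteq> 0\<close> by simp
  qed
  \<comment> \<open>The norm of the shifted eigenvalue \<open>l - p\<close>, whose conjugate is
    \<open>2 * c - l - p\<close>.\<close>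
  define n where "n l = (l - p) * (2 * c - l - p)" for l
  have norm_cases: "2 * c0 \<in> \<int> \<and> (n l = p \<and> \<bar>2 * c0\<bar> \<le> p + 1 \<or> n l = - p \<and> \<bar>2 * c0\<bar> \<le> p - 1)"
    if l: "l \<in> S" "l \<noteq> c" for l
  proof -
    have i1: "l - p \<notin> \<rat>"
    proof
      assume "l - p \<in> \<rat>"
      then have "l - p + p \<in> \<rat>" using p_rat by (rule Rats_add)
      then show False using irr[OF l] by simp
    qed
    have i2: "2 * c - l - p \<notin> \<rat>"
    proof
      assume "2 * c - l - p \<in> \<rat>"
      moreover have "2 * c - p \<in> \<rat>" using p_rat cd(1) by auto
      ultimately have "2 * c - p - (2 * c - l - p) \<in> \<rat>" by (metis Rats_diff)
      then show False using irr[OF l] by simp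
    qed
    have s: "l - p + (2 * c - l - p) = 2 * c0" by (simp add: c0_def)
    have "n l = c0\<^sup>2 - (l - c) * (l - c)" by (simp add: n_def c0_def algebra_simps power2_eq_square)
    then have "n l \<in> \<rat>" using prodrat[OF l(1) l(1)] c0 by auto
    then show ?thesis
      using qeig_conjugate_pair[OF qe[OF l(1)] qe[OF cj(1)[OF l(1)]] i1 i2] c0 unfolding s n_def by auto
  qed
  have c_type: "c0 = 1 \<or> c0 = -1 \<or> c0 = p \<or> c0 = - p" if "c \<in> S"
    using qeig_rational[OF qe[OF that]] c0 by (simp add: c0_def)
  \<comment> \<open>All pairs share the trace \<open>2 * c0\<close>, so equal norms mean equal or
    conjugate eigenvalues, which carry the same sign.\<close>
  have nosplit: False if "l \<in> S" "k \<in> S" "n l = n k" "\<epsilon> l \<noteq> \<epsilon> k" for l k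
  proof -
    have "(l - k) * (2 * c - l - k) = 0" using that(3) by (simp add: n_def algebra_simps)
    then have "l = k \<or> l = 2 * c - k" by auto
    then show False using that(4) cj(2)[OF that(2)] by auto
  qed
  have no_plus: False if l: "l \<in> S" "l \<noteq> c" "n l = p" for l
  proof -
    have tl: "2 * c0 \<in> \<int>" "\<bar>2 * c0\<bar> \<le> p + 1" using norm_cases[OF l(1,2)] l(3) p3 by auto
    have sq: "(l - c)\<^sup>2 = c0\<^sup>2 - p" using l(3) by (simp add: n_def c0_def algebra_simps power2_eq_square)
    \<comment> \<open>With norm \<open>p\<close>, the values \<open>1\<close> and \<open>-1\<close>
      of \<open>c0\<close> would make \<open>(l - c)\<^sup>2 = 1 - p\<close> negative, and
      \<open>p\<close> and \<open>- p\<close> violate the trace bound.\<close>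
    have "c \<notin> S"
    proof
      assume "c \<in> S"
      from c_type[OF this] show False
      proof (elim disjE)
        assume "c0 = 1"
        then show False using sq p3 by (smt (verit) zero_le_power2 one_power2)
      next
        assume "c0 = -1"
        then show False using sq p3 by (smt (verit) zero_le_power2 power2_minus one_power2)
      qed (use tl p3 in auto)
    qed
    obtain k where k: "k \<in> S" "\<epsilon> k \<noteq> \<epsilon> l"
      using l12 eps[OF l(1)] by (metis one_neq_neg_one)
    have "k \<noteq> c" using k \<open>c \<notin> S\<close> by auto
    have nk: "n k = - p" "\<bar>2 * c0\<bar> \<le> p - 1"
      using norm_cases[OF k(1) \<open>k \<noteq> c\<close>] nosplit[OF k(1) l(1)] k(2) l(3) by auto
    have e1: "(l - p) * (2 * c0 - (l - p)) = p" using l(3) by (simp add: n_def c0_def algebra_simps)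
    have e2: "(k - p) * (2 * c0 - (k - p)) = - p" using nk(1) by (simp add: n_def c0_def algebra_simps)
    have e3: "(l - p - c0) * (k - p - c0) \<in> \<rat>" using prodrat[OF l(1) k(1)] by (simp add: c0_def)
    show False by (rule conjugate_types_exclusive[OF tl(1) nk(2) e1 e2 e3])
  qed
  have nminus: "n l = - p" if "l \<in> S" "l \<noteq> c" for l using norm_cases[OF that] no_plus[OF that] by blast
  \<comment> \<open>All irrational elements now have norm \<open>- p\<close> and hence one common
    sign; the other sign can only sit at \<open>c\<close>.\<close>
  have cS: "c \<in> S"
  proof (rule ccontr)
    assume "c \<notin> S"
    then have "n l1 = n l2" using nminus l12 by metis
    then show False using nosplit[OF l12(1,3)] l12 by simp
  qed
  obtain l where l: "l \<in> S" "l \<noteq> c" "\<epsilon> l = - \<epsilon> c"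
  proof (cases "\<epsilon> c = 1")
    case True
    then have "l2 \<noteq> c" using l12 by auto
    then show ?thesis using that[of l2] l12 True by auto
  next
    case False
    then have "\<epsilon> c = -1" "l1 \<noteq> c" using eps[OF cS] l12 by auto
    then show ?thesis using that[of l1] l12 by auto
  qed
  have el: "\<epsilon> k = - \<epsilon> c" if "k \<in> S" "k \<noteq> c" for k
    using nosplit[OF that(1) l(1)] nminus[OF that] nminus[OF l(1,2)] l(3) by auto
  have "\<bar>2 * c0\<bar> \<le> p - 1" using norm_cases[OF l(1,2)] nminus[OF l(1,2)] p3 by auto
  then have c01: "c0 = 1 \<or> c0 = -1" using c_type[OF cS] p3 by auto
  have "(l - c)\<^sup>2 = c0\<^sup>2 + p"
    using nminus[OF l(1,2)] by (simp add: n_def c0_def algebra_simps power2_eq_square)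
  then have sq: "(l - c)\<^sup>2 = 1 + p" using c01 by auto
  \<comment> \<open>Together with the next exclusion this gives \<open>r \<ge> 4\<close>, hence at
    least five old vertices against a combined support of at most four.\<close>
  have "p \<noteq> 3"
  proof
    assume "p = 3"
    then have "(l - c)\<^sup>2 = 2\<^sup>2" using sq by simp
    then have "l - c = 2 \<or> l - c = - 2" by (rule power2_eq_iff[THEN iffD1])
    then have "l = c + 2 \<or> l = c - 2" by linarith
    then show False using irr[OF l(1,2)] cd(1) by auto
  qed
  moreover have "r \<noteq> 3"
  proof
    assume "r = 3"
    then have "prime (4 :: nat)" using pr by simp
    moreover have "(2 :: nat) dvd 4" by simp
    ultimately have "2 = (1 :: nat) \<or> 2 = (4 :: nat)" using prime_nat_iff by blast
    then show False by simp
  qed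
  ultimately have r4: "r \<ge> 4" using r2 by (auto simp: p_def)
  have nz: "pair_state a b x \<noteq> 0 \<or> pair_state a' b' x \<noteq> 0" if x: "x \<in> Inl ` V" for x
  proof (rule ccontr)
    assume "\<not> ?thesis"
    then have z: "pair_state a b x = 0" "pair_state a' b' x = 0" by auto
    have xQ: "x \<in> Q" using x by (auto simp: Q_vertices_def)
    \<comment> \<open>All other signs are opposite to \<open>\<epsilon> c\<close>, so this
      combination isolates twice the component at \<open>c\<close>.\<close>
    have "0 = of_real (\<epsilon> c) * pair_state a b x + pair_state a' b' x" using z by simp
    also have "\<dots> = (\<Sum>k\<in>S. of_real (\<epsilon> c) * h k x + of_real (\<epsilon> k) * h k x)"
      unfolding v w[OF xQ] by (simp add: sum.distrib sum_distrib_left)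
    also have "\<dots> = (\<Sum>k\<in>S. if k = c then 2 * of_real (\<epsilon> c) * h c x else 0)"
      by (intro sum.cong) (auto simp: el)
    also have "\<dots> = 2 * of_real (\<epsilon> c) * h c x" using fin cS by simp
    finally have "h c x = 0" using eps[OF cS] by auto
    then show False using qeig_pm_one_all_nonzero[OF qe[OF cS]] c01 x by (auto simp: c0_def)
  qed
  have "Inl ` V \<subseteq> {a, b, a', b'}"
  proof
    fix x :: "'v + 'v set" assume "x \<in> Inl ` V"
    from nz[OF this] show "x \<in> {a, b, a', b'}"
      by (auto simp: pair_state_def char_vec_def split: if_split_asm)
  qed
  then have "card (Inl ` V :: ('v + 'v set) set) \<le> card {a, b, a', b'}" by (intro card_mono) auto
  also have "\<dots> \<le> 4" by (auto simp: card_insert_if)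
  finally have "card V \<le> 4" by (simp add: card_image)
  then show False using card_V r4 by simp
qed

lemma no_lap_PPST: "\<not> lap_PPST Q (Q_adj V E) a b a' b'"
proof
  assume pst: "lap_PPST Q (Q_adj V E) a b a' b'"
  interpret L: int_sym_matrix Q "lap_matrix Q (Q_adj V E)"
    by (rule int_sym_matrix_lap[OF simple_graph_Q])
  obtain S h and \<epsilon> :: "real \<Rightarrow> real" where sd: "L.spectral_decomposition S h (pair_state a b)"
    and eps: "\<forall>l\<in>S. \<epsilon> l = 1 \<or> \<epsilon> l = -1"
    and w: "\<forall>x\<in>Q. pair_state a' b' x = (\<Sum>l\<in>S. of_real (\<epsilon> l) * h l x)"
    and e12: "\<exists>l\<in>S. \<epsilon> l = 1" "\<exists>l\<in>S. \<epsilon> l = -1"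
    and alt: "S \<subseteq> \<rat> \<or> (\<exists>c \<delta>. c \<in> \<rat> \<and> \<delta> \<notin> \<rat> \<and> \<delta>\<^sup>2 \<in> \<rat> \<and>
        (\<forall>l\<in>S. \<exists>q\<in>\<rat>. l = c + q * \<delta> \<and> c - q * \<delta> \<in> S \<and> \<epsilon> (c - q * \<delta>) = \<epsilon> l))"
    using lap_PPST_structure[OF simple_graph_Q pst] by blast
  have ab: "a \<in> Q" "b \<in> Q" "a \<noteq> b" using pst by (auto simp: lap_PPST_def)
  have fin: "finite S" and v: "\<And>x. pair_state a b x = (\<Sum>l\<in>S. h l x)"
    and eig: "\<And>l. l \<in> S \<Longrightarrow> L.eig (of_real l) (h l)" and nz: "\<And>l. l \<in> S \<Longrightarrow> \<exists>x\<in>Q. h l x \<noteq> 0"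
    using sd by (auto simp: L.spectral_decomposition_def)
  have qe: "qeig (l - p) (h l)" if "l \<in> S" for l
    using eig[OF that] nz[OF that] unfolding qeig_def laplacian_eq_act[OF simple_graph_Q]
    by (simp add: L.eig_def)
  \<comment> \<open>A pair state has coordinate sum zero and is orthogonal to the constant
    eigenvectors, which removes the case \<open>m = - p\<close>.\<close>
  have zero: "0 \<notin> S"
  proof
    assume z: "0 \<in> S"
    then have "qeig (- p) (h 0)" using qe[of 0] by simp
    then obtain k where k: "\<And>z. z \<in> Q \<Longrightarrow> h 0 z = k" using qeig_zero_const by blast
    have k0: "k \<noteq> 0" using nz[OF z] k by auto
    have "(\<Sum>x\<in>Q. pair_state a b x * h 0 x) = (\<Sum>x\<in>Q. \<Sum>l\<in>S. h l x * h 0 x)"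
      by (simp add: v sum_distrib_right)
    also have "\<dots> = (\<Sum>l\<in>S. \<Sum>x\<in>Q. h l x * h 0 x)" by (rule sum.swap)
    also have "\<dots> = (\<Sum>l\<in>S. if l = 0 then \<Sum>x\<in>Q. h 0 x * h 0 x else 0)"
      using L.eig_orth[OF eig eig[OF z]] by (intro sum.cong) auto
    also have "\<dots> = (\<Sum>x\<in>Q. h 0 x * h 0 x)" using fin z by simp
    also have "\<dots> = of_nat (card Q) * (k * k)" by (simp add: k)
    finally have "(\<Sum>x\<in>Q. pair_state a b x * h 0 x) = of_nat (card Q) * (k * k)" .
    moreover have "(\<Sum>x\<in>Q. pair_state a b x * h 0 x) = 0"
    proof -
      have "(\<Sum>x\<in>Q. pair_state a b x * h 0 x) = (\<Sum>x\<in>Q. (if x = a then k else 0) - (if x = b then k else 0))"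
        by (intro sum.cong) (auto simp: pair_state_def char_vec_def k)
      then show ?thesis using L.finite_X ab by (simp add: sum_subtractf)
    qed
    ultimately show False using k0 ab(1) L.finite_X by auto
  qed
  obtain l1 l2 where l12: "l1 \<in> S" "\<epsilon> l1 = 1" "l2 \<in> S" "\<epsilon> l2 = -1" using e12 by blast
  from alt show False
  proof
    assume S: "S \<subseteq> \<rat>"
    have rat: "l - p = 1 \<or> l - p = -1 \<or> l - p = p" if "l \<in> S" for l
    proof -
      have "l - p \<in> \<rat>" using S that by (auto simp: p_def)
      moreover have "l - p \<noteq> - p" using zero that by auto
      ultimately show ?thesis using qeig_rational[OF qe[OF that]] by blast
    qed
    have "l1 \<noteq> l2" using l12 by auto
    then show False using no_rational_transfer[OF fin qe v rat l12(1,3)] by blast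
  next
    assume "\<exists>c \<delta>. c \<in> \<rat> \<and> \<delta> \<notin> \<rat> \<and> \<delta>\<^sup>2 \<in> \<rat> \<and>
        (\<forall>l\<in>S. \<exists>q\<in>\<rat>. l = c + q * \<delta> \<and> c - q * \<delta> \<in> S \<and> \<epsilon> (c - q * \<delta>) = \<epsilon> l)"
    then obtain c \<delta> where cd: "c \<in> \<rat>" "\<delta> \<notin> \<rat>" "\<delta>\<^sup>2 \<in> \<rat>"
      "\<And>l. l \<in> S \<Longrightarrow> \<exists>q\<in>\<rat>. l = c + q * \<delta> \<and> c - q * \<delta> \<in> S \<and> \<epsilon> (c - q * \<delta>) = \<epsilon> l" by blast
    show False
      by (rule no_irrational_transfer[OF fin qe v _ _ l12 cd]) (use w eps in blast)+
  qed
qed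

end

theorem theorem3p2:
  fixes V :: "'v set" and E :: "'v \<Rightarrow> 'v \<Rightarrow> bool" and r :: nat
  assumes "simple_graph V E"
    and "connected_graph V E"
    and "regular V E r"
    and "r \<ge> 2"
    and "prime (r + 1)"
  shows "\<not> (\<exists>a b c d. lap_PPST (Q_vertices V E) (Q_adj V E) a b c d)"
proof -
  interpret prime_regular_graph V E r by unfold_locales (use assms in auto)
  show ?thesis using no_lap_PPST by blast
qed

end
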